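(* The quantity $s_P$ obeys the following. (i) If $h=0$, then $s_P=1$ when $\xi(s)=s^2$, and $s_P=0$ when $c_p\neq0$ for at least one even $p\ge4$. (ii) If $h\ne0$, then $s_P>0$.
   Context: Fix $h\ge 0$ and reals $c_p\ge 0$, $p\in 2\mathbb{N}=\{2,4,6,\dots\}$, with $\sum_{p}c_p=1$ and $\sum_p 2^pc_p<\infty$; put $\xi(s)=\sum_{p\in2\mathbb{N}}c_ps^p$. Let $\mathcal{K}$ be the set of measures $\nu(ds)=1_{[0,1)}(s)\gamma(s)ds+\Delta\delta_{\{1\}}(ds)$ on $[0,1]$ with $\gamma$ nonnegative, nondecreasing and right-continuous on $[0,1)$ and $\Delta>0$. For $\nu\in\mathcal{K}$ let $\mathcal{Q}(\nu)=\frac12\bigl(\int_0^1(\xi'(s)+h^2)\nu(ds)+\int_0^1\frac{dq}{\nu((q,1])}\bigr)$. It is known that $\mathcal{Q}$ has a unique minimizer over $\mathcal{K}$, $\nu_P(ds)=\gamma_P(s)1_{[0,1)}(s)ds+\Delta_P\delta_{\{1\}}(ds)$. The Parisi measure $\rho_P$ is the measure on $[0,1)$ with $\rho_P([0,s])=\gamma_P(s)$ for all $s\in[0,1)$. Put $\Gamma=(\mathrm{supp}\,\rho_P)\cup\{1\}$ and $s_P=\min\Gamma$. *)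

theory Defs
  imports "HOL-Analysis.Analysis"
begin

definition pos_even :: "nat set"
  where "pos_even = {p. even p \<and> 2 \<le> p}"

text \<open>The coefficients are given by a function on \<^typ>\<open>nat\<close>; only its values on
  \<^const>\<open>pos_even\<close> matter.\<close>

definition mixture_coeffs :: "(nat \<Rightarrow> real) \<Rightarrow> bool"
  where "mixture_coeffs c \<longleftrightarrow>
    (\<forall>p\<in>pos_even. 0 \<le> c p) \<and> (c has_sum 1) pos_even \<and> (\<lambda>p. 2 ^ p * c p) summable_on pos_even"

definition xi :: "(nat \<Rightarrow> real) \<Rightarrow> real \<Rightarrow> real"
  where "xi c s = (\<Sum>\<^sub>\<infinity>p\<in>pos_even. c p * s ^ p)"

text \<open>Only the values of \<open>\<gamma>\<close> on \<open>[0,1)\<close> matter; \<open>\<gamma>\<close> may be unbounded near 1.\<close>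

definition admissible :: "(real \<Rightarrow> real) \<Rightarrow> real \<Rightarrow> bool"
  where "admissible \<gamma> \<Delta> \<longleftrightarrow>
    (\<forall>s\<in>{0..<1}. 0 \<le> \<gamma> s) \<and> mono_on {0..<1} \<gamma> \<and>
    (\<forall>s\<in>{0..<1}. continuous (at_right s) \<gamma>) \<and> 0 < \<Delta>"

text \<open>The measure \<open>1\<^bsub>[0,1)\<^esub>(s) \<gamma>(s) ds + \<Delta> \<delta>\<^sub>1(ds)\<close> on \<open>[0,1]\<close>. As \<^const>\<open>measure_of\<close> yields
  the null measure when its argument is not countably additive, the lemma
  \<open>emeasure_nu\<close> below is what shows that this is the intended object.\<close>

definition nu :: "(real \<Rightarrow> real) \<Rightarrow> real \<Rightarrow> real measure"
  where "nu \<gamma> \<Delta> = measure_of {0..1} (sets (restrict_space borel {0..1}))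
    (\<lambda>A. (\<integral>\<^sup>+s\<in>A \<inter> {0..<1}. ennreal (\<gamma> s) \<partial>lborel) + ennreal \<Delta> * indicator A 1)"

lemma space_nu: "space (nu \<gamma> \<Delta>) = {0..1}"
  unfolding nu_def by (subst space_measure_of) (auto simp: sets_restrict_space)

lemma sets_nu: "sets (nu \<gamma> \<Delta>) = sets (restrict_space borel {0..1})"
proof -
  have "sets (restrict_space borel {0..1::real}) = sigma_sets {0..1} (sets (restrict_space borel {0..1}))"
    using sets.sigma_sets_eq[of "restrict_space borel {0..1::real}"] by (simp add: space_restrict_space)
  then show ?thesis
    unfolding nu_def by (subst sets_measure_of) (auto simp: sets_restrict_space)
qed

lemma emeasure_nu:
  assumes adm: "admissible \<gamma> \<Delta>" and A: "A \<in> sets (restrict_space borel {0..1})"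
  shows "emeasure (nu \<gamma> \<Delta>) A =
    (\<integral>\<^sup>+s\<in>A \<inter> {0..<1}. ennreal (\<gamma> s) \<partial>lborel) + ennreal \<Delta> * indicator A 1"
proof -
  let ?M = "restrict_space borel {0..1::real}"
  let ?f = "\<lambda>s. ennreal (\<gamma> s) * indicator {0..<1} s"
  have "\<gamma> \<in> borel_measurable (restrict_space borel {0..<1})"
    using adm by (intro borel_measurable_mono_on_fnc) (simp add: admissible_def)
  then have "(\<lambda>s. ennreal (\<gamma> s)) \<in> borel_measurable (restrict_space borel {0..<1})"
    by measurable
  then have f: "?f \<in> borel_measurable lborel"
    by (subst (asm) borel_measurable_restrict_space_iff_ennreal) auto
  have borelM: "B \<in> sets borel" if "B \<in> sets ?M" for B
    using that by (auto simp: sets_restrict_space)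
  let ?\<mu> = "\<lambda>A. (\<integral>\<^sup>+s\<in>A \<inter> {0..<1}. ennreal (\<gamma> s) \<partial>lborel) + ennreal \<Delta> * indicator A 1"
  let ?\<mu>' = "\<lambda>A. emeasure (density lborel ?f) A + ennreal \<Delta> * indicator A 1"
  have eq: "?\<mu> B = ?\<mu>' B" if "B \<in> sets ?M" for B
  proof -
    have "(\<integral>\<^sup>+s\<in>B \<inter> {0..<1}. ennreal (\<gamma> s) \<partial>lborel) = (\<integral>\<^sup>+s\<in>B. ?f s \<partial>lborel)"
      by (intro nn_integral_cong) (simp split: split_indicator)
    then show ?thesis
      using borelM[OF that] f by (simp add: emeasure_density)
  qed
  have "countably_additive (sets ?M) ?\<mu>"
    unfolding countably_additive_def
  proof safe
    fix B :: "nat \<Rightarrow> real set"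
    assume B: "range B \<subseteq> sets ?M" "disjoint_family B" "(\<Union>i. B i) \<in> sets ?M"
    have B': "range B \<subseteq> sets borel" and Bi: "B i \<in> sets ?M" for i
      using B(1) borelM by auto
    have "(\<Sum>i. ?\<mu> (B i)) = (\<Sum>i. ?\<mu>' (B i))"
      by (intro suminf_cong eq Bi)
    also have "\<dots> = (\<Sum>i. emeasure (density lborel ?f) (B i)) +
        (\<Sum>i. ennreal \<Delta> * indicator (B i) 1)"
      by (intro suminf_add[symmetric] summableI)
    also have "\<dots> = ?\<mu>' (\<Union>i. B i)"
      using B B' by (subst ennreal_suminf_cmult) (simp add: suminf_emeasure suminf_indicator)
    also have "\<dots> = ?\<mu> (\<Union>i. B i)"
      by (intro eq[symmetric] B)
    finally show "(\<Sum>i. ?\<mu> (B i)) = ?\<mu> (\<Union>i. B i)" .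
  qed
  then show ?thesis
    using A
    by (intro emeasure_measure_of[OF nu_def])
       (auto simp: sets_nu positive_def sets_restrict_space)
qed

definition K_set :: "real measure set"
  where "K_set = {nu \<gamma> \<Delta> | \<gamma> \<Delta>. admissible \<gamma> \<Delta>}"

text \<open>Valued in \<^typ>\<open>ennreal\<close>, since \<open>\<nu>\<close> may be infinite. The division by
  \<^term>\<open>emeasure \<nu> {q<..1}\<close> is that of \<^typ>\<open>ennreal\<close>, so \<open>1 / \<infinity> = 0\<close>; the denominator vanishes only
  at the negligible point \<open>q = 1\<close>.\<close>

definition Q_functional :: "(nat \<Rightarrow> real) \<Rightarrow> real \<Rightarrow> real measure \<Rightarrow> ennreal"
  where "Q_functional c h \<nu> = 1 / 2 *
    ((\<integral>\<^sup>+s. ennreal (deriv (xi c) s + h\<^sup>2) \<partial>\<nu>) +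
     (\<integral>\<^sup>+q\<in>{0..1}. 1 / emeasure \<nu> {q<..1} \<partial>lborel))"

definition parisi_measure :: "(real \<Rightarrow> real) \<Rightarrow> real measure \<Rightarrow> bool"
  where "parisi_measure \<gamma> \<rho> \<longleftrightarrow>
    sets \<rho> = sets (restrict_space borel {0..<1}) \<and>
    (\<forall>s\<in>{0..<1}. emeasure \<rho> {0..s} = ennreal (\<gamma> s))"

definition supp :: "real measure \<Rightarrow> real set"
  where "supp \<rho> = {x \<in> space \<rho>. \<forall>U. open U \<and> x \<in> U \<longrightarrow> 0 < emeasure \<rho> (U \<inter> space \<rho>)}"

definition Gam :: "real measure \<Rightarrow> real set"
  where "Gam \<rho> = supp \<rho> \<union> {1}"

text \<open>The minimum of the (in general infinite) set \<^term>\<open>Gam \<rho>\<close>; the library's \<open>Min\<close> is for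
  finite sets only.\<close>

definition s_P :: "real measure \<Rightarrow> real"
  where "s_P \<rho> = (LEAST s. s \<in> Gam \<rho>)"

text \<open>The two lemmas below show that \<^const>\<open>parisi_measure\<close> is satisfiable for every admissible
  \<open>\<gamma>\<close>, and that the minimum is attained.\<close>

lemma parisi_measure_exists:
  assumes adm: "admissible \<gamma> \<Delta>"
  shows "\<exists>\<rho>. parisi_measure \<gamma> \<rho>"
proof -
  define G where "G t = (if t < 0 then 0 else \<gamma> (1 - exp (- t)))" for t :: real
  define T where "T t = (if t < 0 then 0 else 1 - exp (- t))" for t :: real
  have nonneg: "0 \<le> \<gamma> s" if "0 \<le> s" "s < 1" for s
    using adm that by (simp add: admissible_def)
  have mono: "\<gamma> s \<le> \<gamma> t" if "0 \<le> s" "s \<le> t" "t < 1" for s t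
    using adm that by (auto simp: admissible_def intro: mono_onD)
  have G_mono: "G x \<le> G y" if "x \<le> y" for x y
    using that by (auto simp: G_def intro!: mono nonneg)
  have G_cont: "continuous (at_right a) G" for a
  proof (cases "a < 0")
    case True
    then have "\<forall>\<^sub>F x in at_right a. G x = 0"
      unfolding eventually_at_right_field by (auto simp: G_def intro: exI[of _ 0])
    then show ?thesis
      using True by (simp add: continuous_within G_def tendsto_eventually)
  next
    case False
    let ?b = "1 - exp (- a)"
    have "continuous (at_right ?b) \<gamma>"
      using adm False by (simp add: admissible_def)
    then have lim: "(\<gamma> \<longlongrightarrow> \<gamma> ?b) (at_right ?b)"
      by (simp add: continuous_within)
    have fl: "filterlim (\<lambda>t. 1 - exp (- t)) (at_right ?b) (at_right a)"
    proof -
      have "((\<lambda>t. 1 - exp (- t)) \<longlongrightarrow> ?b) (at_right a)"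
        by (intro tendsto_intros)
      moreover have "\<forall>\<^sub>F t in at_right a. 1 - exp (- t) \<in> {?b<..} \<and> 1 - exp (- t) \<noteq> ?b"
        using eventually_at_right_less[of a] by eventually_elim simp
      ultimately show ?thesis
        unfolding filterlim_at by simp
    qed
    have "((\<lambda>t. \<gamma> (1 - exp (- t))) \<longlongrightarrow> \<gamma> ?b) (at_right a)"
      by (rule filterlim_compose[OF lim fl])
    moreover have "\<forall>\<^sub>F t in at_right a. \<gamma> (1 - exp (- t)) = G t"
      using eventually_at_right_less[of a] by eventually_elim (use False in \<open>simp add: G_def\<close>)
    ultimately have "(G \<longlongrightarrow> \<gamma> ?b) (at_right a)"
      by (rule Lim_transform_eventually)
    then show ?thesis
      using False by (simp add: continuous_within G_def)
  qed
  have T_meas: "T \<in> interval_measure G \<rightarrow>\<^sub>M restrict_space borel {0..<1}"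
    by (intro measurable_restrict_space2) (auto simp: T_def[abs_def])
  define \<rho> where "\<rho> = distr (interval_measure G) (restrict_space borel {0..<1}) T"
  have "emeasure \<rho> {0..s} = ennreal (\<gamma> s)" if s: "0 \<le> s" "s < 1" for s
  proof -
    define b where "b = - ln (1 - s)"
    have b: "0 \<le> b" "1 - exp (- b) = s"
      using s by (simp_all add: b_def)
    have iff: "1 - exp (- t) \<le> s \<longleftrightarrow> t \<le> b" for t
      using b(2) exp_le_cancel_iff[of "- b" "- t"] by linarith
    have "T -` {0..s} \<inter> space (interval_measure G) = {..b}"
    proof -
      have "T t \<in> {0..s} \<longleftrightarrow> t \<le> b" for t
        by (cases "t < 0") (use s b(1) iff[of t] in \<open>simp_all add: T_def\<close>)
      then show ?thesis
        by (simp add: vimage_def atMost_def)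
    qed
    moreover have "{0..s} \<in> sets (restrict_space borel {0..<1})"
      using s by (auto simp: sets_restrict_space_iff)
    ultimately have "emeasure \<rho> {0..s} = emeasure (interval_measure G) {..b}"
      unfolding \<rho>_def using T_meas by (simp add: emeasure_distr)
    also have "\<dots> = ennreal (G b)"
    proof -
      have "{..b} = (\<Union>n::nat. {- real n - 1<..b})"
      proof (safe)
        fix x assume "x \<le> b"
        obtain n :: nat where "- x < real n"
          using reals_Archimedean2 by blast
        then show "x \<in> (\<Union>n::nat. {- real n - 1<..b})"
          using \<open>x \<le> b\<close> by (intro UN_I[of n]) auto
      qed auto
      moreover have "(SUP n::nat. emeasure (interval_measure G) {- real n - 1<..b}) =
          emeasure (interval_measure G) (\<Union>n::nat. {- real n - 1<..b})"
        by (intro SUP_emeasure_incseq) (auto simp: incseq_def)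
      moreover have "emeasure (interval_measure G) {- real n - 1<..b} = ennreal (G b)" for n :: nat
        using b(1) G_mono G_cont
        by (subst emeasure_interval_measure_Ioc) (auto simp: G_def[of "- real n - 1"])
      ultimately show ?thesis
        by simp
    qed
    finally show ?thesis
      using b by (simp add: G_def)
  qed
  then have "parisi_measure \<gamma> \<rho>"
    by (auto simp: parisi_measure_def \<rho>_def)
  then show ?thesis ..
qed

lemma s_P_is_minimum:
  assumes "parisi_measure \<gamma> \<rho>"
  shows "s_P \<rho> \<in> Gam \<rho>" and "\<And>s. s \<in> Gam \<rho> \<Longrightarrow> s_P \<rho> \<le> s"
proof -
  have sp: "space \<rho> = {0..<1}"
    using sets_eq_imp_space_eq[of \<rho> "restrict_space borel {0..<1}"] assms
    by (simp add: parisi_measure_def space_restrict_space)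
  have sub: "0 \<le> s \<and> s \<le> 1" if "s \<in> Gam \<rho>" for s
    using that by (auto simp: Gam_def supp_def sp)
  then have bdd: "bdd_below (Gam \<rho>)"
    by (meson bdd_belowI)
  have ne: "Gam \<rho> \<noteq> {}"
    by (simp add: Gam_def)
  have low: "Inf (Gam \<rho>) \<le> s" if "s \<in> Gam \<rho>" for s
    using that bdd by (rule cInf_lower)
  have 0: "0 \<le> Inf (Gam \<rho>)"
    using ne sub by (intro cInf_greatest) auto
  have mem: "Inf (Gam \<rho>) \<in> Gam \<rho>"
  proof (rule ccontr)
    assume nin: "Inf (Gam \<rho>) \<notin> Gam \<rho>"
    have 1: "Inf (Gam \<rho>) < 1"
      using nin low[of 1] by (auto simp: Gam_def)
    then obtain U where U: "open U" "Inf (Gam \<rho>) \<in> U" "\<not> 0 < emeasure \<rho> (U \<inter> space \<rho>)"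
      using nin 0 by (auto simp: Gam_def supp_def sp)
    have "open (U \<inter> {..<1})"
      using U by auto
    then obtain e where e: "e > 0" "ball (Inf (Gam \<rho>)) e \<subseteq> U \<inter> {..<1}"
      using U 1 by (meson IntI lessThan_iff openE)
    obtain s where s: "s \<in> Gam \<rho>" "s < Inf (Gam \<rho>) + e"
      using cInf_lessD[OF ne, of "Inf (Gam \<rho>) + e"] e(1) by auto
    then have "s \<in> ball (Inf (Gam \<rho>)) e"
      using low[OF s(1)] by (simp add: dist_real_def)
    then have "s \<in> U" "s < 1"
      using e by auto
    then show False
      using s(1) U by (auto simp: Gam_def supp_def)
  qed
  have "s_P \<rho> = Inf (Gam \<rho>)"
    unfolding s_P_def using mem low by (rule Least_equality)
  then show "s_P \<rho> \<in> Gam \<rho>" and "\<And>s. s \<in> Gam \<rho> \<Longrightarrow> s_P \<rho> \<le> s"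
    using mem low by auto
qed

end

theory Submission
  imports Defs
begin

text \<open>
  Put \<open>g q = \<nu>((q,1]) = \<Delta> + \<integral>\<^sub>q\<^sup>1 \<gamma>\<close> and \<open>k = \<xi>' + h\<^sup>2\<close>. Twice the functional is
  \<open>\<integral> k \<gamma> + k(1) \<Delta> + \<integral> 1/g\<close>, a convex function of \<open>(\<gamma>, \<Delta>)\<close>, because \<open>g\<close> is affine in this pair.
  Its derivative at the minimizer, in the direction of a competitor \<open>(\<gamma>', \<Delta>')\<close>, is therefore
  nonnegative. By Fubini it equals
  \<open>\<integral> f (\<gamma>' - \<gamma>) + f(1) (\<Delta>' - \<Delta>)\<close> with \<open>f s = k s - \<integral>\<^sub>0\<^sup>s 1/g\<^sup>2\<close>. This is the lemma
  \<open>slope_inequality\<close>. Since \<open>\<gamma>\<close> is the distribution function of the Parisi measure, \<open>s\<^sub>P\<close> is the point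
  up to which \<open>\<gamma>\<close> vanishes, and each case comes from a suitable competitor.

  If \<open>h \<noteq> 0\<close>, then \<open>f\<close> is positive near 0 because \<open>f(0) = h\<^sup>2\<close>. Setting \<open>\<gamma>\<close> to 0 near the
  origin would decrease the functional unless \<open>\<gamma>\<close> already vanishes there (\<open>vanishes_near_0\<close>).

  If \<open>h = 0\<close> and \<open>\<xi>(s) = s\<^sup>2\<close>, an exchange of integrals turns twice the functional into
  \<open>\<integral> (2 g + 1/g)\<close>. The integrand is smallest exactly at \<open>g = 1/\<surd>2\<close>, so \<open>g\<close> is constant and
  \<open>\<gamma> = 0\<close> (\<open>vanishes_if_linear\<close>).

  If \<open>h = 0\<close> and some \<open>c\<^sub>p\<close> with \<open>p \<ge> 4\<close> is nonzero, suppose that \<open>\<gamma>\<close> vanishes exactly up to a point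
  \<open>s\<^sub>0 > 0\<close>. Below \<open>s\<^sub>0\<close> the tail \<open>g\<close> has a constant value \<open>G\<close>, hence \<open>f s = \<xi>' s - s/G\<^sup>2\<close>. Three facts
  clash. Moving mass of the Parisi measure to the left of \<open>s\<^sub>0\<close> must not help, so \<open>f(s\<^sub>0) \<ge> 0\<close>
  (\<open>slope_nonneg_at_edge\<close>). Replacing \<open>\<gamma>\<close> by its mean over an interval slightly longer than
  \<open>[0,s\<^sub>0]\<close> must not help, so \<open>f(s\<^sub>0)\<close> is at most the mean of \<open>f\<close> over \<open>[0,s\<^sub>0]\<close>
  (\<open>edge_slope_le_average\<close>). But \<open>2 \<xi> s < s \<xi>' s\<close> says that this mean is strictly less than
  \<open>f(s\<^sub>0)/2\<close>. So \<open>\<gamma>\<close> is positive on \<open>(0,1)\<close> (\<open>positive_if_superquadratic\<close>) and \<open>s\<^sub>P = 0\<close>.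
\<close>

section \<open>The mixture as a power series\<close>

definition even_coeff :: "(nat \<Rightarrow> real) \<Rightarrow> nat \<Rightarrow> real"
  where "even_coeff c n = (if n \<in> pos_even then c n else 0)"

lemma even_coeff_nonneg: "mixture_coeffs c \<Longrightarrow> 0 \<le> even_coeff c n"
  by (simp add: even_coeff_def mixture_coeffs_def)

lemma even_coeff_less_2: "n < 2 \<Longrightarrow> even_coeff c n = 0"
  by (simp add: even_coeff_def pos_even_def)

lemma summable_even_coeff_2:
  assumes "mixture_coeffs c"
  shows "summable (\<lambda>n. even_coeff c n * 2 ^ n)"
proof -
  have "(\<lambda>p. 2 ^ p * c p) summable_on pos_even"
    using assms by (simp add: mixture_coeffs_def)
  then have "(\<lambda>n. even_coeff c n * 2 ^ n) summable_on UNIV"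
    by (rule summable_on_cong_neutral[THEN iffD1, rotated -1])
      (auto simp: even_coeff_def)
  then show ?thesis
    by (rule summable_on_UNIV_nonneg_real_iff[THEN iffD1, rotated])
      (simp add: even_coeff_nonneg[OF assms])
qed

lemma summable_even_coeff:
  assumes "mixture_coeffs c" "\<bar>s\<bar> < 2"
  shows "summable (\<lambda>n. even_coeff c n * s ^ n)"
  using powser_inside[OF summable_even_coeff_2[OF assms(1)], of s] assms(2) by simp

lemma xi_eq_suminf:
  assumes c: "mixture_coeffs c" and s: "\<bar>s\<bar> < 2"
  shows "xi c s = (\<Sum>n. even_coeff c n * s ^ n)"
proof -
  have "summable (\<lambda>n. norm (even_coeff c n * s ^ n))"
    using summable_even_coeff[OF c, of "\<bar>s\<bar>"] s even_coeff_nonneg[OF c]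
    by (simp add: abs_mult power_abs)
  then have "((\<lambda>n. even_coeff c n * s ^ n) has_sum (\<Sum>n. even_coeff c n * s ^ n)) UNIV"
    by (rule norm_summable_imp_has_sum) (rule summable_sums[OF summable_even_coeff[OF c s]])
  then have "((\<lambda>p. c p * s ^ p) has_sum (\<Sum>n. even_coeff c n * s ^ n)) pos_even"
    by (rule has_sum_cong_neutral[THEN iffD1, rotated -1]) (auto simp: even_coeff_def)
  then show ?thesis
    unfolding xi_def by (rule infsumI)
qed

lemma xi_has_derivative:
  assumes c: "mixture_coeffs c" and s: "\<bar>s\<bar> < 2"
  shows "(xi c has_real_derivative (\<Sum>n. diffs (even_coeff c) n * s ^ n)) (at s)"
proof -
  have "((\<lambda>x. \<Sum>n. even_coeff c n * x ^ n) has_real_derivative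
      (\<Sum>n. diffs (even_coeff c) n * s ^ n)) (at s)"
    using s by (intro termdiffs_strong[OF summable_even_coeff_2[OF c]]) simp
  then show ?thesis
    by (rule has_field_derivative_transform_within_open[where S="{-2<..<2}"])
      (use s in \<open>auto simp: xi_eq_suminf[OF c]\<close>)
qed

lemma deriv_xi:
  assumes "mixture_coeffs c" "\<bar>s\<bar> < 2"
  shows "deriv (xi c) s = (\<Sum>n. diffs (even_coeff c) n * s ^ n)"
  using xi_has_derivative[OF assms] by (rule DERIV_imp_deriv)

lemma xi_has_deriv:
  assumes "mixture_coeffs c" "\<bar>s\<bar> < 2"
  shows "(xi c has_real_derivative deriv (xi c) s) (at s)"
  using xi_has_derivative[OF assms] deriv_xi[OF assms] by simp

lemma summable_diffs_even_coeff:
  assumes c: "mixture_coeffs c" and s: "\<bar>s\<bar> < 2"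
  shows "summable (\<lambda>n. diffs (even_coeff c) n * s ^ n)"
  by (rule termdiff_converges[where K=2]) (use s summable_even_coeff[OF c] in auto)

lemma continuous_on_deriv_xi:
  assumes c: "mixture_coeffs c"
  shows "continuous_on {0..1} (deriv (xi c))"
proof -
  have "isCont (\<lambda>x. \<Sum>n. diffs (even_coeff c) n * x ^ n) s" if "s \<in> {0..1}" for s
    by (rule isCont_powser[where K="3/2"]) (use that in \<open>auto intro: summable_diffs_even_coeff[OF c]\<close>)
  then have "continuous_on {0..1} (\<lambda>x. \<Sum>n. diffs (even_coeff c) n * x ^ n)"
    by (simp add: continuous_at_imp_continuous_on)
  then show ?thesis
    by (rule continuous_on_cong[THEN iffD1, rotated -1]) (auto simp: deriv_xi[OF c])
qed

lemma deriv_xi_nonneg: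
  assumes c: "mixture_coeffs c" and s: "0 \<le> s" "s \<le> 1"
  shows "0 \<le> deriv (xi c) s"
proof -
  have "0 \<le> (\<Sum>n. diffs (even_coeff c) n * s ^ n)"
    using s even_coeff_nonneg[OF c]
    by (intro suminf_nonneg[OF summable_diffs_even_coeff[OF c]]) (auto simp: diffs_def)
  then show ?thesis
    using s by (simp add: deriv_xi[OF c])
qed

text \<open>Termwise, \<open>s \<xi>'(s) - 2 \<xi>(s)\<close> has the coefficients \<open>(p - 2) c\<^sub>p\<close>. They are nonnegative because
  \<open>p \<ge> 2\<close>, and positive as soon as \<open>p \<ge> 4\<close> occurs.\<close>

lemma sums_s_deriv_xi_minus_2_xi:
  assumes c: "mixture_coeffs c" and s: "\<bar>s\<bar> < 2"
  shows "(\<lambda>n. (real n - 2) * even_coeff c n * s ^ n) sums (s * deriv (xi c) s - 2 * xi c s)"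
proof -
  have "(\<lambda>n. s * (diffs (even_coeff c) n * s ^ n)) sums (s * deriv (xi c) s)"
    using summable_sums[OF summable_diffs_even_coeff[OF assms]] 
    by (intro sums_mult) (simp add: deriv_xi[OF assms])
  then have "(\<lambda>n. real (Suc n) * even_coeff c (Suc n) * s ^ Suc n) sums (s * deriv (xi c) s)"
    by (simp add: diffs_def mult_ac)
  then have "(\<lambda>n. real n * even_coeff c n * s ^ n) sums (s * deriv (xi c) s)"
    by (subst (asm) sums_Suc_iff) simp
  moreover have "(\<lambda>n. 2 * (even_coeff c n * s ^ n)) sums (2 * xi c s)"
    using summable_sums[OF summable_even_coeff[OF assms]]
    by (intro sums_mult) (simp add: xi_eq_suminf[OF assms])
  ultimately have "(\<lambda>n. real n * even_coeff c n * s ^ n - 2 * (even_coeff c n * s ^ n)) sums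
      (s * deriv (xi c) s - 2 * xi c s)"
    by (rule sums_diff)
  then show ?thesis
    by (simp add: algebra_simps)
qed

lemma two_xi_le_s_deriv_xi:
  assumes c: "mixture_coeffs c" and s: "0 \<le> s" "s \<le> 1"
  shows "2 * xi c s \<le> s * deriv (xi c) s"
proof -
  have "0 \<le> (real n - 2) * even_coeff c n * s ^ n" for n
    using s even_coeff_nonneg[OF c, of n] even_coeff_less_2[of n c] by (cases "n < 2") auto
  then have "0 \<le> s * deriv (xi c) s - 2 * xi c s"
    using sums_le[OF _ sums_zero sums_s_deriv_xi_minus_2_xi[OF c, of s]] s by auto
  then show ?thesis by simp
qed

lemma two_xi_less_s_deriv_xi:
  assumes c: "mixture_coeffs c" and p: "even p" "4 \<le> p" "c p \<noteq> 0" and s: "0 < s" "s \<le> 1"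
  shows "2 * xi c s < s * deriv (xi c) s"
proof -
  have "0 \<le> (real n - 2) * even_coeff c n * s ^ n" for n
    using s even_coeff_nonneg[OF c, of n] even_coeff_less_2[of n c] by (cases "n < 2") auto
  moreover have "0 < (real p - 2) * even_coeff c p * s ^ p"
    using p s c by (auto simp: even_coeff_def pos_even_def mixture_coeffs_def intro: order_neq_le_trans)
  ultimately have "0 < (\<Sum>n. (real n - 2) * even_coeff c n * s ^ n)"
    using sums_s_deriv_xi_minus_2_xi[OF c, of s] s
    by (subst suminf_pos_iff) (auto simp: sums_iff)
  then show ?thesis 
    using sums_s_deriv_xi_minus_2_xi[OF c, of s] s by (auto simp: sums_iff)
qed

text \<open>Needed to see that the minimizing measure is finite: the weight \<open>\<xi>'\<close> must be bounded away from
  zero near 1, where \<open>\<gamma>\<close> may blow up.\<close>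

lemma deriv_xi_pos:
  assumes c: "mixture_coeffs c" and s: "0 < s" "s \<le> 1"
  shows "0 < deriv (xi c) s"
proof -
  have "\<exists>p\<in>pos_even. c p \<noteq> 0"
  proof (rule ccontr)
    assume "\<not> ?thesis"
    then have "(c has_sum 0) pos_even"
      by (intro has_sum_0) auto
    then show False
      using c has_sum_unique[of c pos_even 0 1] by (simp add: mixture_coeffs_def)
  qed
  then obtain p where p: "p \<in> pos_even" "c p \<noteq> 0" by blast
  have "0 < even_coeff c p * s ^ p"
    using p s c by (auto simp: even_coeff_def mixture_coeffs_def intro: order_neq_le_trans)
  then have "0 < (\<Sum>n. even_coeff c n * s ^ n)"
    using s even_coeff_nonneg[OF c] by (intro suminf_pos2[where i=p] summable_even_coeff[OF c]) auto
  then have "0 < s * deriv (xi c) s"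
    using two_xi_le_s_deriv_xi[OF c, of s] xi_eq_suminf[OF c, of s] s by simp
  then show ?thesis
    using s by (simp add: zero_less_mult_iff)
qed

text \<open>The hypothesis fixes \<open>\<xi>\<close> only on \<open>[0,1]\<close>, while the derivative is two-sided. Since \<open>\<xi>\<close> is
  differentiable at the endpoints too, the derivative relative to \<open>[0,1]\<close> determines it.\<close>

lemma deriv_xi_square:
  assumes c: "mixture_coeffs c" and sq: "\<forall>s\<in>{0..1}. xi c s = s\<^sup>2" and s: "s \<in> {0..1}"
  shows "deriv (xi c) s = 2 * s"
proof -
  have "(xi c has_real_derivative deriv (xi c) s) (at s within {0..1})"
    using xi_has_deriv[OF c, of s] s by (auto intro: has_field_derivative_at_within)
  then have "((\<lambda>s. s\<^sup>2) has_real_derivative deriv (xi c) s) (at s within {0..1})"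
    by (rule has_field_derivative_transform_within[where d=1]) (use s sq in auto)
  moreover have "((\<lambda>s. s\<^sup>2) has_real_derivative 2 * s) (at s within {0..1})"
    by (auto intro!: derivative_eq_intros)
  ultimately show ?thesis
    using s by (intro has_field_derivative_unique) (auto simp: trivial_limit_within islimpt_Icc)
qed


section \<open>Integrals over real intervals\<close>

lemma set_integral_pos:
  fixes f :: "real \<Rightarrow> real"
  assumes f: "set_integrable lborel A f" and nonneg: "\<And>s. s \<in> A \<Longrightarrow> 0 \<le> f s"
    and ab: "a < b" "{a<..<b} \<subseteq> A" and pos: "\<And>s. a < s \<Longrightarrow> s < b \<Longrightarrow> 0 < f s"
  shows "0 < (LINT s:A|lborel. f s)"
proof -
  let ?F = "\<lambda>s. indicator A s *\<^sub>R f s"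
  have F: "integrable lborel ?F"
    using f by (simp add: set_integrable_def)
  have F0: "0 \<le> ?F s" for s
    using nonneg by (simp add: indicator_def)
  have "integral\<^sup>L lborel ?F \<noteq> 0"
  proof
    assume "integral\<^sup>L lborel ?F = 0"
    then have "AE s in lborel. ?F s = 0"
      using integral_nonneg_eq_0_iff_AE[OF F] F0 by simp
    then have "AE s in lborel. s \<notin> {a<..<b}"
    proof eventually_elim
      case (elim s)
      show ?case
      proof
        assume "s \<in> {a<..<b}"
        then show False
          using elim pos[of s] ab(2) by (auto simp: indicator_def subset_iff)
      qed
    qed
    then have "emeasure lborel {a<..<b} = 0"
      by (subst (asm) AE_iff_measurable[where N="{a<..<b}"]) auto
    then show False
      using ab(1) by simp
  qed
  moreover have "0 \<le> integral\<^sup>L lborel ?F"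
    using F0 by (intro integral_nonneg_AE) auto
  ultimately show ?thesis
    by (simp add: set_lebesgue_integral_def)
qed

lemma set_integrable_bounded_mult:
  fixes f \<eta> :: "real \<Rightarrow> real"
  assumes \<eta>: "set_integrable lborel A \<eta>" and f: "set_borel_measurable lborel A f"
    and B: "\<And>s. s \<in> A \<Longrightarrow> \<bar>f s\<bar> \<le> B"
  shows "set_integrable lborel A (\<lambda>s. f s * \<eta> s)"
  unfolding set_integrable_def
proof (rule Bochner_Integration.integrable_bound)
  show "integrable lborel (\<lambda>s. B * (indicator A s *\<^sub>R \<eta> s))"
    using \<eta> by (simp add: set_integrable_def)
  have "(\<lambda>s. (indicator A s *\<^sub>R f s) * (indicator A s *\<^sub>R \<eta> s)) \<in> borel_measurable lborel"
    using f \<eta> by (intro borel_measurable_times)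
      (auto simp: set_borel_measurable_def set_integrable_def)
  also have "(\<lambda>s. (indicator A s *\<^sub>R f s) * (indicator A s *\<^sub>R \<eta> s)) =
      (\<lambda>s. indicator A s *\<^sub>R (f s * \<eta> s))"
    by (auto simp: fun_eq_iff indicator_def)
  finally show "(\<lambda>s. indicator A s *\<^sub>R (f s * \<eta> s)) \<in> borel_measurable lborel" .
  have "\<bar>f s\<bar> * \<bar>\<eta> s\<bar> \<le> \<bar>B\<bar> * \<bar>\<eta> s\<bar>" if "s \<in> A" for s
    using B[OF that] by (intro mult_right_mono) auto
  then show "AE s in lborel. norm (indicator A s *\<^sub>R (f s * \<eta> s)) \<le> norm (B * (indicator A s *\<^sub>R \<eta> s))"
    by (intro AE_I2) (auto simp: indicator_def abs_mult)
qed

lemma set_integrable_continuous_mult: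
  fixes f \<eta> :: "real \<Rightarrow> real"
  assumes \<eta>: "set_integrable lborel {0..<1} \<eta>" and f: "continuous_on {0..1} f"
  shows "set_integrable lborel {0..<1} (\<lambda>s. f s * \<eta> s)"
proof -
  have "compact (f ` {0..1})"
    using f by (intro compact_continuous_image) auto
  then obtain B where B: "\<And>s. s \<in> {0..1} \<Longrightarrow> \<bar>f s\<bar> \<le> B"
    by (metis bounded_iff compact_imp_bounded imageI real_norm_def)
  have "set_borel_measurable lborel {0..<1} f"
    unfolding set_borel_measurable_def
    using borel_measurable_continuous_on_indicator[of "{0..<1}" f] continuous_on_subset[OF f, of "{0..<1}"]
    by (simp add: subset_iff)
  then show ?thesis
    using B by (intro set_integrable_bounded_mult[OF \<eta>, where B=B]) auto
qed

lemma set_integrable_bounded: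
  fixes f :: "real \<Rightarrow> real"
  assumes "f \<in> borel_measurable borel" and "\<And>q. \<bar>f q\<bar> \<le> B"
  shows "set_integrable lborel {a..b} f"
  unfolding set_integrable_def
  by (rule integrableI_bounded_set_indicator[where B=B])
    (use assms emeasure_lborel_cbox_finite[of a b] in auto)

lemma set_integral_Ico_eq_integral:
  fixes f :: "real \<Rightarrow> real"
  assumes f: "continuous_on {0..b} f"
  shows "(LINT s:{0..<b}|lborel. f s) = integral {0..b} f"
    and "set_integrable lborel {0..<b} f"
proof -
  have int: "set_integrable lborel {0..b} f"
    by (rule borel_integrable_atLeastAtMost'[OF f])
  then show int': "set_integrable lborel {0..<b} f"
    by (rule set_integrable_subset) auto
  have "(LINT s:{0..<b}|lborel. f s) = (LINT s:{0..b}|lborel. f s)"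
    unfolding set_lebesgue_integral_def
  proof (rule integral_cong_AE)
    show "AE s in lborel. indicator {0..<b} s *\<^sub>R f s = indicator {0..b} s *\<^sub>R f s"
      using AE_lborel_singleton[of b] by eventually_elim (auto simp: indicator_def)
  qed (use int int' in \<open>auto simp: set_integrable_def\<close>)
  then show "(LINT s:{0..<b}|lborel. f s) = integral {0..b} f"
    using set_borel_integral_eq_integral(2)[OF int] by simp
qed

text \<open>Both sides integrate \<open>v q \<eta> s\<close> over the triangle \<open>0 \<le> q \<le> s < 1\<close>.\<close>

lemma set_integral_double_swap:
  fixes v \<eta> :: "real \<Rightarrow> real"
  assumes v: "v \<in> borel_measurable borel" and B: "\<And>q. \<bar>v q\<bar> \<le> B"
    and \<eta>: "set_integrable lborel {0..<1} \<eta>"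
  shows "(LINT q:{0..1}|lborel. v q * (LINT s:{max 0 q..<1}|lborel. \<eta> s)) =
    (LINT s:{0..<1}|lborel. (LINT q:{0..s}|lborel. v q) * \<eta> s)"
proof -
  \<comment> \<open>\<open>\<eta>\<close> is measurable only on \<open>[0,1)\<close>; extending it by 0 makes the integrand jointly measurable.\<close>
  define e where "e s = indicator {0..<1} s *\<^sub>R \<eta> s" for s
  have e: "integrable lborel e"
    using \<eta> by (simp add: set_integrable_def e_def[abs_def])
  have [measurable]: "e \<in> borel_measurable borel" "v \<in> borel_measurable borel"
    using borel_measurable_integrable[OF e] v by simp_all
  define F where "F q s = (if 0 \<le> q \<and> q \<le> s then v q * e s else 0)" for q s
  have F_meas: "case_prod F \<in> borel_measurable (lborel \<Otimes>\<^sub>M lborel)"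
    unfolding F_def by measurable
  have B0: "0 \<le> B"
    using B[of 0] by linarith
  have F_le: "\<bar>F q s\<bar> \<le> indicator {0..1} q * (B * \<bar>e s\<bar>)" for q s
    using B[of q] B0 by (auto simp: F_def e_def indicator_def abs_mult intro: mult_right_mono)
  have F_s: "integrable lborel (F q)" for q
  proof (rule Bochner_Integration.integrable_bound)
    show "integrable lborel (\<lambda>s. B * e s)"
      using e by simp
    show "F q \<in> borel_measurable lborel"
      unfolding F_def[abs_def] by measurable
    show "AE s in lborel. norm (F q s) \<le> norm (B * e s)"
      using B[of q] B0 by (intro AE_I2) (auto simp: F_def abs_mult intro: mult_right_mono)
  qed
  have F_norm: "integrable lborel (\<lambda>q. LINT s|lborel. norm (F q s))"
  proof (rule Bochner_Integration.integrable_bound)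
    show "integrable lborel (\<lambda>q::real. indicator {0..1} q * (B * (LINT s|lborel. \<bar>e s\<bar>)) :: real)"
      by (intro integrable_mult_left integrable_real_indicator) (simp_all add: emeasure_lborel_Icc_eq)
    show "(\<lambda>q. LINT s|lborel. norm (F q s)) \<in> borel_measurable lborel"
      using F_meas by measurable
    have "(LINT s|lborel. norm (F q s)) \<le> (LINT s|lborel. indicator {0..1} q * (B * \<bar>e s\<bar>))" for q
      using F_le F_s e by (intro integral_mono) auto
    then have "\<bar>LINT s|lborel. norm (F q s)\<bar> \<le> \<bar>indicator {0..1} q * (B * (LINT s|lborel. \<bar>e s\<bar>))\<bar>" for q
      using integral_nonneg_AE[where M=lborel and f="\<lambda>s. norm (F q s)"]
      by (auto intro: order_trans[OF _ abs_ge_self])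
    then show "AE q in lborel. norm (LINT s|lborel. norm (F q s))
        \<le> norm (indicator {0..1} q * (B * (LINT s|lborel. \<bar>e s\<bar>)))"
      by simp
  qed
  have "integrable (lborel \<Otimes>\<^sub>M lborel) (case_prod F)"
    by (rule lborel_pair.Fubini_integrable[OF F_meas]) (simp_all only: split_conv F_norm F_s AE_I2)
  then have swap: "(LINT s|lborel. LINT q|lborel. F q s) = (LINT q|lborel. LINT s|lborel. F q s)"
    by (rule lborel_pair.Fubini_integral)
  have "(LINT s|lborel. F q s) = indicator {0..1} q *\<^sub>R (v q * (LINT s:{max 0 q..<1}|lborel. \<eta> s))" for q
  proof (cases "q \<in> {0..1}")
    case True
    then have "F q s = v q * (indicator {max 0 q..<1} s *\<^sub>R \<eta> s)" for s
      by (auto simp: F_def e_def indicator_def)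
    then show ?thesis
      using True by (simp add: set_lebesgue_integral_def)
  next
    case False
    then have "F q s = 0" for s
      by (auto simp: F_def e_def indicator_def)
    then show ?thesis
      using False by simp
  qed
  moreover have "(LINT q|lborel. F q s) = indicator {0..<1} s *\<^sub>R ((LINT q:{0..s}|lborel. v q) * \<eta> s)" for s
  proof -
    have "F q s = (indicator {0..s} q *\<^sub>R v q) * e s" for q
      by (auto simp: F_def indicator_def)
    then show ?thesis
      by (simp add: set_lebesgue_integral_def e_def)
  qed
  ultimately show ?thesis
    using swap by (simp add: set_lebesgue_integral_def)
qed

section \<open>Densities and their tails\<close>

text \<open>The pairs for which \<open>\<nu>\<close> is a finite measure. Every minimizer is of this kind, and on these pairs all
  integrals below are integrals of real functions.\<close>

definition finite_admissible :: "(real \<Rightarrow> real) \<Rightarrow> real \<Rightarrow> bool"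
  where "finite_admissible \<gamma> \<Delta> \<longleftrightarrow> admissible \<gamma> \<Delta> \<and> set_integrable lborel {0..<1} \<gamma>"

lemma finite_admissibleD:
  assumes "finite_admissible \<gamma> \<Delta>"
  shows "\<And>s. 0 \<le> s \<Longrightarrow> s < 1 \<Longrightarrow> 0 \<le> \<gamma> s" "\<And>s t. 0 \<le> s \<Longrightarrow> s \<le> t \<Longrightarrow> t < 1 \<Longrightarrow> \<gamma> s \<le> \<gamma> t"
    "0 < \<Delta>" "set_integrable lborel {0..<1} \<gamma>"
    "\<And>s. 0 \<le> s \<Longrightarrow> s < 1 \<Longrightarrow> continuous (at_right s) \<gamma>"
  using assms by (auto simp: finite_admissible_def admissible_def intro: mono_onD)

lemma finite_admissible_const: "0 \<le> a \<Longrightarrow> 0 < \<Delta> \<Longrightarrow> finite_admissible (\<lambda>_. a) \<Delta>"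
  by (auto simp: finite_admissible_def admissible_def set_integrable_def mono_on_def)

lemma finite_admissible_mass: "finite_admissible \<gamma> \<Delta> \<Longrightarrow> 0 < \<Delta>' \<Longrightarrow> finite_admissible \<gamma> \<Delta>'"
  by (simp add: finite_admissible_def admissible_def)

text \<open>Competitors are obtained by pasting constants and \<open>\<gamma>\<close> itself, in increasing order.\<close>

lemma finite_admissible_if:
  assumes \<alpha>: "finite_admissible \<alpha> \<Delta>" and \<beta>: "finite_admissible \<beta> \<Delta>"
    and le: "\<And>s t. 0 \<le> s \<Longrightarrow> s < b \<Longrightarrow> b \<le> t \<Longrightarrow> t < 1 \<Longrightarrow> \<alpha> s \<le> \<beta> t"
  shows "finite_admissible (\<lambda>s. if s < b then \<alpha> s else \<beta> s) \<Delta>"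
proof -
  note A = finite_admissibleD[OF \<alpha>] and B = finite_admissibleD[OF \<beta>]
  have "continuous (at_right s) (\<lambda>s. if s < b then \<alpha> s else \<beta> s)" if s: "0 \<le> s" "s < 1" for s
  proof (cases "s < b")
    case True
    then have "\<forall>\<^sub>F t in at_right s. \<alpha> t = (if t < b then \<alpha> t else \<beta> t)"
      by (auto simp: eventually_at_right_field)
    moreover have "(\<alpha> \<longlongrightarrow> \<alpha> s) (at_right s)"
      using A(5)[OF s] by (simp add: continuous_within)
    ultimately show ?thesis
      using True by (simp add: continuous_within) (rule Lim_transform_eventually)
  next
    case False
    then have "\<forall>\<^sub>F t in at_right s. \<beta> t = (if t < b then \<alpha> t else \<beta> t)"
      by (auto simp: eventually_at_right_field intro: exI[of _ "s + 1"])
    moreover have "(\<beta> \<longlongrightarrow> \<beta> s) (at_right s)"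
      using B(5)[OF s] by (simp add: continuous_within)
    ultimately show ?thesis
      using False by (simp add: continuous_within) (rule Lim_transform_eventually)
  qed
  moreover have "set_integrable lborel {0..<1} (\<lambda>s. if s < b then \<alpha> s else \<beta> s)"
  proof -
    have "integrable lborel (\<lambda>s. indicator {..<b} s *\<^sub>R (indicator {0..<1} s *\<^sub>R \<alpha> s) +
        indicator {b..} s *\<^sub>R (indicator {0..<1} s *\<^sub>R \<beta> s))"
      using A(4)[unfolded set_integrable_def] B(4)[unfolded set_integrable_def]
      by (intro Bochner_Integration.integrable_add integrable_mult_indicator[where f="\<lambda>s. indicator {0..<1} s *\<^sub>R \<alpha> s"]
          integrable_mult_indicator[where f="\<lambda>s. indicator {0..<1} s *\<^sub>R \<beta> s"]) simp_all
    also have "(\<lambda>s. indicator {..<b} s *\<^sub>R (indicator {0..<1} s *\<^sub>R \<alpha> s) +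
        indicator {b..} s *\<^sub>R (indicator {0..<1} s *\<^sub>R \<beta> s)) =
        (\<lambda>s. indicator {0..<1} s *\<^sub>R (if s < b then \<alpha> s else \<beta> s))"
      by (auto simp: fun_eq_iff indicator_def)
    finally show ?thesis
      by (simp add: set_integrable_def)
  qed
  moreover have "mono_on {0..<1} (\<lambda>s. if s < b then \<alpha> s else \<beta> s)"
    using A(2) B(2) le by (auto simp: mono_on_def)
  ultimately show ?thesis
    using A(1,3) B(1) by (auto simp: finite_admissible_def admissible_def)
qed

lemma finite_admissible_convex:
  assumes \<alpha>: "finite_admissible \<alpha> \<Delta>" and \<beta>: "finite_admissible \<beta> \<Delta>'" and t: "0 < t" "t < 1"
  shows "finite_admissible (\<lambda>s. (1 - t) * \<alpha> s + t * \<beta> s) ((1 - t) * \<Delta> + t * \<Delta>')"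
proof -
  note A = finite_admissibleD[OF \<alpha>] and B = finite_admissibleD[OF \<beta>]
  have "set_integrable lborel {0..<1} (\<lambda>s. (1 - t) * \<alpha> s + t * \<beta> s)"
    using A(4) B(4) by (intro set_integral_add) auto
  then show ?thesis
    using A B t unfolding finite_admissible_def admissible_def
    by (auto simp: mono_on_def intro!: continuous_intros add_mono mult_left_mono add_pos_pos)
qed

text \<open>The mass \<open>\<nu>((q,1])\<close>. The maximum makes the function antimonotone on the whole line, hence Borel
  measurable, although \<open>\<gamma>\<close> is arbitrary outside \<open>[0,1)\<close>.\<close>

definition tail :: "(real \<Rightarrow> real) \<Rightarrow> real \<Rightarrow> real \<Rightarrow> real"
  where "tail \<gamma> \<Delta> q = \<Delta> + (LINT s:{max 0 q..<1}|lborel. \<gamma> s)"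

lemma set_integrable_tail:
  "set_integrable lborel {0..<1} \<gamma> \<Longrightarrow> set_integrable lborel {max 0 q..<1::real} (\<gamma> :: real \<Rightarrow> real)"
  by (erule set_integrable_subset) auto

lemma tail_antimono:
  assumes "finite_admissible \<gamma> \<Delta>" "q \<le> r"
  shows "tail \<gamma> \<Delta> r \<le> tail \<gamma> \<Delta> q"
proof -
  have "(LINT s:{max 0 r..<1}|lborel. \<gamma> s) \<le> (LINT s:{max 0 q..<1}|lborel. \<gamma> s)"
    using set_integrable_tail[OF finite_admissibleD(4)[OF assms(1)]]
    unfolding set_lebesgue_integral_def set_integrable_def
    by (intro integral_mono) (use assms in \<open>auto simp: indicator_def intro: finite_admissibleD(1)[OF assms(1)]\<close>)
  then show ?thesis
    by (simp add: tail_def)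
qed

lemma tail_1: "1 \<le> q \<Longrightarrow> tail \<gamma> \<Delta> q = \<Delta>"
  by (simp add: tail_def max_def set_lebesgue_integral_def)

lemma tail_ge:
  assumes "finite_admissible \<gamma> \<Delta>"
  shows "\<Delta> \<le> tail \<gamma> \<Delta> q"
  using tail_antimono[OF assms, of q "max 1 q"] tail_1[of "max 1 q" \<gamma> \<Delta>] by simp

lemma tail_pos:
  assumes "finite_admissible \<gamma> \<Delta>"
  shows "0 < tail \<gamma> \<Delta> q"
  using tail_ge[OF assms, of q] finite_admissibleD(3)[OF assms] by simp

lemma tail_le_0:
  assumes "finite_admissible \<gamma> \<Delta>"
  shows "tail \<gamma> \<Delta> q \<le> tail \<gamma> \<Delta> 0"
proof -
  have "tail \<gamma> \<Delta> q = tail \<gamma> \<Delta> (max 0 q)"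
    by (simp add: tail_def)
  then show ?thesis
    using tail_antimono[OF assms, of 0 "max 0 q"] by simp
qed

lemma tail_measurable:
  assumes "finite_admissible \<gamma> \<Delta>"
  shows "tail \<gamma> \<Delta> \<in> borel_measurable borel"
proof -
  have "mono (\<lambda>q. - tail \<gamma> \<Delta> q)"
    using tail_antimono[OF assms] by (auto simp: mono_def)
  then have "(\<lambda>q. - (- tail \<gamma> \<Delta> q)) \<in> borel_measurable borel"
    by (intro borel_measurable_uminus borel_measurable_mono)
  then show ?thesis
    by simp
qed

lemma tail_split:
  assumes "finite_admissible \<gamma> \<Delta>" "0 \<le> q" "q \<le> r" "r \<le> 1"
  shows "tail \<gamma> \<Delta> q = (LINT s:{q..<r}|lborel. \<gamma> s) + tail \<gamma> \<Delta> r"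
proof -
  have "{q..<1} = {q..<r} \<union> {r..<1}"
    using assms by auto
  moreover have "(LINT s:{q..<r} \<union> {r..<1}|lborel. \<gamma> s) =
      (LINT s:{q..<r}|lborel. \<gamma> s) + (LINT s:{r..<1}|lborel. \<gamma> s)"
    using assms
    by (intro set_integral_Un) (auto intro!: set_integrable_subset[OF finite_admissibleD(4)[OF assms(1)]])
  ultimately show ?thesis
    using assms by (simp add: tail_def)
qed

lemma tail_convex:
  assumes \<alpha>: "finite_admissible \<alpha> \<Delta>" and \<beta>: "finite_admissible \<beta> \<Delta>'"
  shows "tail (\<lambda>s. (1 - t) * \<alpha> s + t * \<beta> s) ((1 - t) * \<Delta> + t * \<Delta>') q =
    (1 - t) * tail \<alpha> \<Delta> q + t * tail \<beta> \<Delta>' q"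
proof -
  note set_integrable_tail[OF finite_admissibleD(4)[OF \<alpha>]] set_integrable_tail[OF finite_admissibleD(4)[OF \<beta>]]
  then have "(LINT s:{max 0 q..<1}|lborel. (1 - t) * \<alpha> s + t * \<beta> s) =
      (1 - t) * (LINT s:{max 0 q..<1}|lborel. \<alpha> s) + t * (LINT s:{max 0 q..<1}|lborel. \<beta> s)"
    by (subst set_integral_add) auto
  then show ?thesis
    by (simp add: tail_def algebra_simps)
qed

lemma set_integrable_tail_power:
  assumes \<gamma>: "finite_admissible \<gamma> \<Delta>"
  shows "set_integrable lborel {a..b} (\<lambda>q. 1 / tail \<gamma> \<Delta> q ^ n)"
proof (rule set_integrable_bounded)
  show "(\<lambda>q. 1 / tail \<gamma> \<Delta> q ^ n) \<in> borel_measurable borel"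
    using tail_measurable[OF \<gamma>] by measurable
  show "\<bar>1 / tail \<gamma> \<Delta> q ^ n\<bar> \<le> 1 / \<Delta> ^ n" for q
    using tail_ge[OF \<gamma>, of q] tail_pos[OF \<gamma>, of q] finite_admissibleD(3)[OF \<gamma>]
    by (auto intro!: divide_left_mono power_mono)
qed


section \<open>The variational inequality\<close>

text \<open>Twice the functional at the measure with density \<open>\<gamma>\<close> and atom \<open>\<Delta>\<close>, for \<open>k = \<xi>' + h\<^sup>2\<close>.\<close>

definition energy :: "(real \<Rightarrow> real) \<Rightarrow> (real \<Rightarrow> real) \<Rightarrow> real \<Rightarrow> real"
  where "energy k \<gamma> \<Delta> =
    (LINT s:{0..<1}|lborel. k s * \<gamma> s) + k 1 * \<Delta> + (LINT q:{0..1}|lborel. 1 / tail \<gamma> \<Delta> q)"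

text \<open>First-order expansion of \<open>1/x\<close> in the direction \<open>d\<close> with an explicit quadratic remainder. The
  bound \<open>x + d \<ge> 0\<close>, which holds because the competitor's tail is nonnegative, keeps
  \<open>x + t d \<ge> x/2\<close> for \<open>t \<le> 1/2\<close>. So the remainder is uniform in \<open>q\<close> when \<open>x\<close> and \<open>x + d\<close> are the two
  tails at \<open>q\<close>.\<close>

lemma inverse_perturbation_le:
  fixes x d t m M :: real
  assumes "0 < m" "m \<le> x" "0 \<le> x + d" "0 \<le> t" "t \<le> 1/2" "\<bar>d\<bar> \<le> M"
  shows "1 / (x + t * d) \<le> 1 / x - t * (d / x\<^sup>2) + t\<^sup>2 * (2 * M\<^sup>2 / m ^ 3)"
proof -
  have x: "0 < x" using assms by simp
  have "0 \<le> (1/2 - t) * x + t * (x + d)"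
    using mult_nonneg_nonneg[of "1/2 - t" x] mult_nonneg_nonneg[of t "x + d"] assms x by simp
  then have y: "x / 2 \<le> x + t * d"
    by (simp add: algebra_simps)
  then have y0: "0 < x + t * d" using x by linarith
  have "1 / (x + t * d) - 1 / x + t * (d / x\<^sup>2) = t\<^sup>2 * (d\<^sup>2 / (x\<^sup>2 * (x + t * d)))"
  proof -
    define y where "y = x + t * d"
    have "1 / y - 1 / x + (y - x) / x\<^sup>2 = (y - x)\<^sup>2 / (x\<^sup>2 * y)"
      using x y0[folded y_def] by (simp add: field_simps power2_eq_square)
    then show ?thesis
      by (simp add: y_def power_mult_distrib)
  qed
  also have "\<dots> \<le> t\<^sup>2 * (M\<^sup>2 / (m\<^sup>2 * (m / 2)))"
  proof (intro mult_left_mono frac_le mult_mono)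
    show "d\<^sup>2 \<le> M\<^sup>2"
      using assms(6) by (metis abs_ge_zero order_trans power2_abs power_mono)
    show "m\<^sup>2 \<le> x\<^sup>2" using assms by (intro power_mono) auto
    show "m / 2 \<le> x + t * d" using y assms by linarith
  qed (use assms in auto)
  also have "\<dots> = t\<^sup>2 * (2 * M\<^sup>2 / m ^ 3)"
    by (simp add: power3_eq_cube power2_eq_square)
  finally show ?thesis by simp
qed

locale energy_minimizer =
  fixes k \<gamma> :: "real \<Rightarrow> real" and \<Delta> :: real
  assumes k_cont: "continuous_on {0..1} k"
    and fin: "finite_admissible \<gamma> \<Delta>"
    and minimal: "\<And>\<gamma>' \<Delta>'. finite_admissible \<gamma>' \<Delta>' \<Longrightarrow> energy k \<gamma> \<Delta> \<le> energy k \<gamma>' \<Delta>'"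
begin

lemmas finD = finite_admissibleD[OF fin]

text \<open>The gradient of the energy: by \<open>slope_inequality\<close> below, adding \<open>t \<eta>\<close> to \<open>\<gamma>\<close> changes the energy by
  \<open>t \<integral> slope s \<eta> s ds\<close> to first order, and \<open>slope 1\<close> plays the same part for the atom.\<close>

definition slope :: "real \<Rightarrow> real"
  where "slope s = k s - (LINT q:{0..s}|lborel. 1 / (tail \<gamma> \<Delta> q)\<^sup>2)"

text \<open>On the segment from \<open>(\<gamma>, \<Delta>)\<close> to the competitor, at parameter \<open>t\<close>, minimality gives
  \<open>0 \<le> t (L - A) + t\<^sup>2 C\<close> with \<open>A\<close> and \<open>L\<close> the left and the right side below. Divide by \<open>t\<close> and let \<open>t\<close> tend to 0.\<close>

lemma variational_inequality:
  assumes fin': "finite_admissible \<gamma>' \<Delta>'"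
  shows "(LINT q:{0..1}|lborel. (tail \<gamma>' \<Delta>' q - tail \<gamma> \<Delta> q) / (tail \<gamma> \<Delta> q)\<^sup>2) \<le>
    (LINT s:{0..<1}|lborel. k s * (\<gamma>' s - \<gamma> s)) + k 1 * (\<Delta>' - \<Delta>)" (is "?A \<le> ?L")
proof -
  note fin'D = finite_admissibleD[OF fin']
  define C where "C = 2 * (tail \<gamma> \<Delta> 0 + tail \<gamma>' \<Delta>' 0)\<^sup>2 / \<Delta> ^ 3"
  have [measurable]: "tail \<gamma> \<Delta> \<in> borel_measurable borel" "tail \<gamma>' \<Delta>' \<in> borel_measurable borel"
    using fin fin' by (simp_all add: tail_measurable)
  have dM: "\<bar>tail \<gamma>' \<Delta>' q - tail \<gamma> \<Delta> q\<bar> \<le> tail \<gamma> \<Delta> 0 + tail \<gamma>' \<Delta>' 0" for q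
    using tail_pos[OF fin, of q] tail_pos[OF fin', of q] tail_le_0[OF fin, of q] tail_le_0[OF fin', of q]
    by linarith
  have int_d: "set_integrable lborel {0..1} (\<lambda>q. (tail \<gamma>' \<Delta>' q - tail \<gamma> \<Delta> q) / (tail \<gamma> \<Delta> q)\<^sup>2)"
  proof (rule set_integrable_bounded)
    show "\<bar>(tail \<gamma>' \<Delta>' q - tail \<gamma> \<Delta> q) / (tail \<gamma> \<Delta> q)\<^sup>2\<bar> \<le> (tail \<gamma> \<Delta> 0 + tail \<gamma>' \<Delta>' 0) / \<Delta>\<^sup>2" for q
      using dM[of q] tail_ge[OF fin, of q] finD(3) by (auto simp: abs_divide intro!: frac_le power_mono)
  qed measurable
  have int_k: "set_integrable lborel {0..<1} (\<lambda>s. k s * \<gamma> s)" "set_integrable lborel {0..<1} (\<lambda>s. k s * \<gamma>' s)"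
    using finD(4) fin'D(4) k_cont by (simp_all add: set_integrable_continuous_mult)
  have L: "?L = (LINT s:{0..<1}|lborel. k s * \<gamma>' s) - (LINT s:{0..<1}|lborel. k s * \<gamma> s) + k 1 * (\<Delta>' - \<Delta>)"
    using int_k by (simp add: right_diff_distrib)
  have step: "?A - ?L \<le> t * C" if t: "0 < t" "t < 1/2" for t
  proof -
    define \<gamma>t \<Delta>t where "\<gamma>t s = (1 - t) * \<gamma> s + t * \<gamma>' s" and "\<Delta>t = (1 - t) * \<Delta> + t * \<Delta>'" for s
    have fin_t: "finite_admissible \<gamma>t \<Delta>t"
      using finite_admissible_convex[OF fin fin', of t] t by (simp add: \<gamma>t_def[abs_def] \<Delta>t_def)
    have tail_t: "tail \<gamma>t \<Delta>t q = tail \<gamma> \<Delta> q + t * (tail \<gamma>' \<Delta>' q - tail \<gamma> \<Delta> q)" for q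
      using tail_convex[OF fin fin', of t q] by (simp add: \<gamma>t_def[abs_def] \<Delta>t_def algebra_simps)
    have "(LINT s:{0..<1}|lborel. k s * \<gamma>t s) =
        (LINT s:{0..<1}|lborel. (1 - t) * (k s * \<gamma> s) + t * (k s * \<gamma>' s))"
      by (simp add: \<gamma>t_def algebra_simps)
    also have "\<dots> = (1 - t) * (LINT s:{0..<1}|lborel. k s * \<gamma> s) + t * (LINT s:{0..<1}|lborel. k s * \<gamma>' s)"
      using int_k by (subst set_integral_add) auto
    finally have lin: "(LINT s:{0..<1}|lborel. k s * \<gamma>t s) + k 1 * \<Delta>t =
        (LINT s:{0..<1}|lborel. k s * \<gamma> s) + k 1 * \<Delta> + t * ?L"
      unfolding L by (simp add: \<Delta>t_def algebra_simps)
    have int_1: "set_integrable lborel {0..1} (\<lambda>q. 1 / tail \<gamma> \<Delta> q)" "set_integrable lborel {0..1} (\<lambda>q. 1 / tail \<gamma>t \<Delta>t q)"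
      using set_integrable_tail_power[OF fin, of 0 1 1] set_integrable_tail_power[OF fin_t, of 0 1 1] by simp_all
    have int_c: "set_integrable lborel {0..1::real} (\<lambda>q. t\<^sup>2 * C)"
      by (rule set_integrable_bounded[where B="\<bar>t\<^sup>2 * C\<bar>"]) auto
    have int_td: "set_integrable lborel {0..1} (\<lambda>q. t * ((tail \<gamma>' \<Delta>' q - tail \<gamma> \<Delta> q) / (tail \<gamma> \<Delta> q)\<^sup>2))"
      using int_d by (intro set_integrable_mult_right)
    have "(LINT q:{0..1}|lborel. 1 / tail \<gamma>t \<Delta>t q) \<le> (LINT q:{0..1}|lborel.
        1 / tail \<gamma> \<Delta> q - t * ((tail \<gamma>' \<Delta>' q - tail \<gamma> \<Delta> q) / (tail \<gamma> \<Delta> q)\<^sup>2) + t\<^sup>2 * C)"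
    proof (rule set_integral_mono)
      show "1 / tail \<gamma>t \<Delta>t q \<le>
          1 / tail \<gamma> \<Delta> q - t * ((tail \<gamma>' \<Delta>' q - tail \<gamma> \<Delta> q) / (tail \<gamma> \<Delta> q)\<^sup>2) + t\<^sup>2 * C" for q
        unfolding tail_t C_def
        using finD(3) tail_ge[OF fin, of q] tail_pos[OF fin', of q] t dM[of q]
        by (intro inverse_perturbation_le) auto
    qed (intro set_integral_add set_integral_diff int_1 int_td int_c)+
    also have "\<dots> = (LINT q:{0..1}|lborel. 1 / tail \<gamma> \<Delta> q) - t * ?A + t\<^sup>2 * C"
      unfolding set_integral_add(2)[OF set_integral_diff(1)[OF int_1(1) int_td] int_c]
        set_integral_diff(2)[OF int_1(1) int_td] set_integral_mult_right
      by (simp add: set_lebesgue_integral_def)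
    finally have "energy k \<gamma>t \<Delta>t \<le> energy k \<gamma> \<Delta> + t * (?L - ?A + t * C)"
      using lin by (simp add: energy_def algebra_simps power2_eq_square)
    then have "0 \<le> t * (?L - ?A + t * C)"
      using minimal[OF fin_t] by linarith
    then show ?thesis
      using t by (simp add: zero_le_mult_iff)
  qed
  have "((\<lambda>t. t * C) \<longlongrightarrow> 0 * C) (at_right 0)"
    by (intro tendsto_intros)
  moreover have "\<forall>\<^sub>F t in at_right 0. ?A - ?L \<le> t * C"
    using step by (auto simp: eventually_at_right_field intro!: exI[of _ "1/2"])
  ultimately have "?A - ?L \<le> 0 * C"
    by (intro tendsto_lowerbound[where F="at_right (0::real)"]) auto
  then show ?thesis
    by simp
qed

lemma abs_inverse_tail_square_le: "\<bar>1 / (tail \<gamma> \<Delta> q)\<^sup>2\<bar> \<le> 1 / \<Delta>\<^sup>2"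
  using tail_ge[OF fin, of q] tail_pos[OF fin, of q] finD(3)
  by (auto intro!: divide_left_mono power_mono)

lemma continuous_on_slope: "continuous_on {0..1} slope"
proof -
  let ?v = "\<lambda>q. 1 / (tail \<gamma> \<Delta> q)\<^sup>2"
  have int: "set_integrable lborel {a..b} ?v" for a b
    by (rule set_integrable_tail_power[OF fin])
  have "?v integrable_on {0..1}"
    using set_borel_integral_eq_integral(1)[OF int] .
  then have "continuous_on {0..1} (\<lambda>s. integral {0..s} ?v)"
    by (rule indefinite_integral_continuous_1)
  then show ?thesis
    unfolding slope_def set_borel_integral_eq_integral(2)[OF int]
    by (intro continuous_on_diff k_cont)
qed

text \<open>The variational inequality tested against the densities themselves instead of their tails:
  Fubini moves the tail integral of \<open>\<gamma>' - \<gamma>\<close> onto \<open>1/g\<^sup>2\<close>.\<close>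

lemma slope_inequality:
  assumes fin': "finite_admissible \<gamma>' \<Delta>'"
  shows "0 \<le> (LINT s:{0..<1}|lborel. slope s * (\<gamma>' s - \<gamma> s)) + slope 1 * (\<Delta>' - \<Delta>)"
proof -
  let ?v = "\<lambda>q. 1 / (tail \<gamma> \<Delta> q)\<^sup>2" and ?\<eta> = "\<lambda>s. \<gamma>' s - \<gamma> s"
  have \<eta>: "set_integrable lborel {0..<1} ?\<eta>"
    using finD(4) finite_admissibleD(4)[OF fin'] by (intro set_integral_diff)
  have v: "?v \<in> borel_measurable borel"
    using tail_measurable[OF fin] by measurable
  have int_v: "set_integrable lborel {0..1} ?v"
    by (rule set_integrable_tail_power[OF fin])
  have tail_diff: "tail \<gamma>' \<Delta>' q - tail \<gamma> \<Delta> q = (LINT s:{max 0 q..<1}|lborel. ?\<eta> s) + (\<Delta>' - \<Delta>)" for q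
    using set_integrable_tail[OF finD(4), of q] set_integrable_tail[OF finite_admissibleD(4)[OF fin'], of q]
    by (simp add: tail_def)
  have int_d: "set_integrable lborel {0..1} (\<lambda>q. ?v q * (LINT s:{max 0 q..<1}|lborel. ?\<eta> s))"
  proof -
    have "(\<lambda>q. LINT s:{max 0 q..<1}|lborel. ?\<eta> s) =
        (\<lambda>q. tail \<gamma>' \<Delta>' q - tail \<gamma> \<Delta> q - (\<Delta>' - \<Delta>))"
      by (simp add: tail_diff)
    also have "\<dots> \<in> borel_measurable borel"
      using tail_measurable[OF fin] tail_measurable[OF fin'] by measurable
    finally have [measurable]: "(\<lambda>q. LINT s:{max 0 q..<1}|lborel. ?\<eta> s) \<in> borel_measurable borel" .
    show ?thesis
    proof (rule set_integrable_bounded)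
      show "(\<lambda>q. ?v q * (LINT s:{max 0 q..<1}|lborel. ?\<eta> s)) \<in> borel_measurable borel"
        using v by measurable
      show "\<bar>?v q * (LINT s:{max 0 q..<1}|lborel. ?\<eta> s)\<bar> \<le>
          1 / \<Delta>\<^sup>2 * (tail \<gamma>' \<Delta>' 0 + tail \<gamma> \<Delta> 0 + \<bar>\<Delta>' - \<Delta>\<bar>)" for q
        unfolding abs_mult
        using abs_inverse_tail_square_le[of q] tail_diff[of q] tail_pos[OF fin, of q] tail_pos[OF fin', of q]
          tail_le_0[OF fin, of q] tail_le_0[OF fin', of q]
        by (intro mult_mono) auto
    qed
  qed
  have int_c: "set_integrable lborel {0..1} (\<lambda>q. ?v q * (\<Delta>' - \<Delta>))"
    using int_v by (intro set_integrable_mult_left)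
  have "(LINT q:{0..1}|lborel. (tail \<gamma>' \<Delta>' q - tail \<gamma> \<Delta> q) / (tail \<gamma> \<Delta> q)\<^sup>2) =
      (LINT q:{0..1}|lborel. ?v q * (LINT s:{max 0 q..<1}|lborel. ?\<eta> s) + ?v q * (\<Delta>' - \<Delta>))"
    by (simp add: tail_diff add_divide_distrib)
  also have "\<dots> = (LINT q:{0..1}|lborel. ?v q * (LINT s:{max 0 q..<1}|lborel. ?\<eta> s)) +
      (LINT q:{0..1}|lborel. ?v q) * (\<Delta>' - \<Delta>)"
    by (simp only: set_integral_add(2)[OF int_d int_c] set_integral_mult_left)
  also have "(LINT q:{0..1}|lborel. ?v q * (LINT s:{max 0 q..<1}|lborel. ?\<eta> s)) =
      (LINT s:{0..<1}|lborel. (LINT q:{0..s}|lborel. ?v q) * ?\<eta> s)"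
    by (rule set_integral_double_swap[OF v abs_inverse_tail_square_le \<eta>])
  also have "\<dots> = (LINT s:{0..<1}|lborel. k s * ?\<eta> s - slope s * ?\<eta> s)"
    by (simp add: slope_def left_diff_distrib)
  also have "\<dots> = (LINT s:{0..<1}|lborel. k s * ?\<eta> s) - (LINT s:{0..<1}|lborel. slope s * ?\<eta> s)"
    by (rule set_integral_diff(2)[OF set_integrable_continuous_mult[OF \<eta> k_cont]
          set_integrable_continuous_mult[OF \<eta> continuous_on_slope]])
  finally show ?thesis
    using variational_inequality[OF fin'] by (simp add: slope_def algebra_simps)
qed

end


section \<open>Where the minimizing density vanishes\<close>

context energy_minimizer
begin

lemma no_descent_direction:
  assumes fin': "finite_admissible \<gamma>' \<Delta>" and ab: "0 \<le> a" "a < b" "b \<le> 1"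
    and le: "\<And>s. 0 \<le> s \<Longrightarrow> s < 1 \<Longrightarrow> slope s * (\<gamma>' s - \<gamma> s) \<le> 0"
    and less: "\<And>s. a < s \<Longrightarrow> s < b \<Longrightarrow> slope s * (\<gamma>' s - \<gamma> s) < 0"
  shows False
proof -
  have "set_integrable lborel {0..<1} (\<lambda>s. slope s * (\<gamma>' s - \<gamma> s))"
    using finD(4) finite_admissibleD(4)[OF fin'] continuous_on_slope
    by (intro set_integrable_continuous_mult set_integral_diff(1))
  then have "set_integrable lborel {0..<1} (\<lambda>s. - (slope s * (\<gamma>' s - \<gamma> s)))"
    by (simp add: set_integrable_def)
  then have "0 < (LINT s:{0..<1}|lborel. - (slope s * (\<gamma>' s - \<gamma> s)))"
    by (rule set_integral_pos[where a=a and b=b]) (use ab le less in \<open>auto simp: less_imp_le\<close>)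
  also have "\<dots> = - (LINT s:{0..<1}|lborel. slope s * (\<gamma>' s - \<gamma> s))"
    by (simp add: set_lebesgue_integral_def)
  finally show False
    using slope_inequality[OF fin'] by simp
qed

lemma slope_ge:
  assumes "0 \<le> s"
  shows "k s - s / \<Delta>\<^sup>2 \<le> slope s"
proof -
  have "(LINT q:{0..s}|lborel. 1 / (tail \<gamma> \<Delta> q)\<^sup>2) \<le> (LINT q:{0..s}|lborel. 1 / \<Delta>\<^sup>2)"
  proof (rule set_integral_mono)
    show "set_integrable lborel {0..s} (\<lambda>q. 1 / \<Delta>\<^sup>2)"
      by (rule set_integrable_bounded[where B="1 / \<Delta>\<^sup>2"]) auto
    show "1 / (tail \<gamma> \<Delta> q)\<^sup>2 \<le> 1 / \<Delta>\<^sup>2" for q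
      using abs_inverse_tail_square_le[of q] by simp
  qed (rule set_integrable_tail_power[OF fin])
  also have "\<dots> = s / \<Delta>\<^sup>2"
    using assms by (simp add: set_lebesgue_integral_def)
  finally show ?thesis
    by (simp add: slope_def)
qed

text \<open>Near 0 the slope stays positive, because it is at least \<open>\<eta> - s/\<Delta>\<^sup>2\<close>. Deleting \<open>\<gamma>\<close> there is thus a
  descent direction if \<open>\<gamma>\<close> is positive on \<open>(0,1)\<close>.\<close>

lemma vanishes_near_0:
  assumes \<eta>: "0 < \<eta>" and k: "\<And>s. 0 \<le> s \<Longrightarrow> s \<le> 1 \<Longrightarrow> \<eta> \<le> k s"
  shows "\<exists>\<epsilon>. 0 < \<epsilon> \<and> \<epsilon> < 1 \<and> \<gamma> \<epsilon> = 0"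
proof (rule ccontr)
  assume "\<not> ?thesis"
  then have pos: "0 < \<gamma> s" if "0 < s" "s < 1" for s
    using that finD(1)[of s] by (force simp: less_le)
  \<comment> \<open>small enough for \<open>s/\<Delta>\<^sup>2 < \<eta>\<close> whenever \<open>s < \<epsilon>\<close>\<close>
  define \<epsilon> where "\<epsilon> = min (1/2) (\<eta> * \<Delta>\<^sup>2 / 2)"
  have \<epsilon>: "0 < \<epsilon>" "\<epsilon> < 1" "\<epsilon> < \<eta> * \<Delta>\<^sup>2"
    using \<eta> finD(3) by (auto simp: \<epsilon>_def min_def)
  have slope: "0 < slope s" if "0 \<le> s" "s < \<epsilon>" for s
  proof -
    have "s / \<Delta>\<^sup>2 < \<eta>"
      using that \<epsilon> finD(3) by (simp add: divide_less_eq)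
    then show ?thesis
      using slope_ge[of s] k[of s] that \<epsilon> by simp
  qed
  define \<gamma>' where "\<gamma>' s = (if s < \<epsilon> then 0 else \<gamma> s)" for s
  have fin': "finite_admissible \<gamma>' \<Delta>"
    unfolding \<gamma>'_def using \<epsilon> finD
    by (intro finite_admissible_if finite_admissible_const fin) auto
  show False
  proof (rule no_descent_direction[OF fin', of 0 \<epsilon>])
    show "slope s * (\<gamma>' s - \<gamma> s) \<le> 0" if "0 \<le> s" "s < 1" for s
      using slope[of s] finD(1)[of s] that by (auto simp: \<gamma>'_def)
    show "slope s * (\<gamma>' s - \<gamma> s) < 0" if "0 < s" "s < \<epsilon>" for s
      using slope[of s] pos[of s] that \<epsilon> by (auto simp: \<gamma>'_def)
  qed (use \<epsilon> in auto)
qed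

text \<open>For \<open>k s = 2 s\<close> the energy is \<open>\<integral> (2 g + 1/g)\<close>, whose integrand is minimized pointwise by the
  constant \<open>a = 1/\<surd>2\<close>. The variational inequality with the constant tail \<open>a\<close> as competitor reads
  \<open>\<integral> 2 (a - g)\<^sup>2 (a + g) / g\<^sup>2 \<le> 0\<close>. If \<open>\<gamma>\<close> were positive at \<open>s\<close>, it would be positive on \<open>[s,1)\<close>,
  \<open>g\<close> would be strictly decreasing there, and \<open>g \<noteq> a\<close> on a whole interval.\<close>

lemma vanishes_if_linear:
  assumes k: "\<And>s. 0 \<le> s \<Longrightarrow> s \<le> 1 \<Longrightarrow> k s = 2 * s" and s: "0 \<le> s" "s < 1"
  shows "\<gamma> s = 0"
proof (rule ccontr)
  assume "\<gamma> s \<noteq> 0"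
  then have \<gamma>s: "0 < \<gamma> s"
    using finD(1)[OF s] by simp
  define a :: real where "a = 1 / sqrt 2"
  have a: "0 < a" "a\<^sup>2 = 1 / 2"
    by (simp_all add: a_def power_divide)
  let ?g = "tail \<gamma> \<Delta>"
  have g: "0 < ?g q" for q
    by (rule tail_pos[OF fin])
  have [measurable]: "?g \<in> borel_measurable borel"
    by (rule tail_measurable[OF fin])
  have fin': "finite_admissible (\<lambda>_. 0) a"
    using a by (intro finite_admissible_const) auto
  have tail': "tail (\<lambda>_. 0) a q = a" for q
    by (simp add: tail_def set_lebesgue_integral_def)
  have int_g: "set_integrable lborel {0..1} ?g"
    by (rule set_integrable_bounded[where B="?g 0"])
      (use g tail_le_0[OF fin] in \<open>auto simp: abs_of_pos\<close>)
  have int_c: "set_integrable lborel {0..1} (\<lambda>q::real. r)" for r :: real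
    by (rule set_integrable_bounded[where B="\<bar>r\<bar>"]) auto
  have int_c01: "(LINT q:{0..1::real}|lborel. r) = r" for r :: real
    by (simp add: set_lebesgue_integral_def)
  have "(LINT q:{0..1}|lborel. 2 * (LINT s:{max 0 q..<1}|lborel. \<gamma> s)) =
      (LINT s:{0..<1}|lborel. (LINT q:{0..s}|lborel. 2) * \<gamma> s)"
    by (rule set_integral_double_swap[OF _ _ finD(4), where B=2]) auto
  also have "\<dots> = (LINT s:{0..<1}|lborel. - (k s * (0 - \<gamma> s)))"
  proof (rule set_lebesgue_integral_cong)
    have "(LINT q:{0..s}|lborel. 2) = 2 * s" if "0 \<le> s" for s :: real
      using that by (simp add: set_lebesgue_integral_def)
    then show "\<forall>s. s \<in> {0..<1} \<longrightarrow> (LINT q:{0..s}|lborel. 2) * \<gamma> s = - (k s * (0 - \<gamma> s))"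
      using k by auto
  qed simp
  also have "\<dots> = - (LINT s:{0..<1}|lborel. k s * (0 - \<gamma> s))"
    by (simp add: set_lebesgue_integral_def)
  also have "(LINT q:{0..1}|lborel. 2 * (LINT s:{max 0 q..<1}|lborel. \<gamma> s)) =
      (LINT q:{0..1}|lborel. 2 * (?g q - \<Delta>))"
    by (simp add: tail_def)
  also have "\<dots> = 2 * (LINT q:{0..1}|lborel. ?g q) - 2 * \<Delta>"
    unfolding set_integral_mult_right set_integral_diff(2)[OF int_g int_c] int_c01 by simp
  finally have "(LINT q:{0..1}|lborel. (a - ?g q) / (?g q)\<^sup>2) \<le> 2 * a - 2 * (LINT q:{0..1}|lborel. ?g q)"
    using variational_inequality[OF fin'] k[of 1] by (simp add: tail' algebra_simps)
  moreover have "2 * a - 2 * (LINT q:{0..1}|lborel. ?g q) = (LINT q:{0..1}|lborel. 2 * (a - ?g q))"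
    unfolding set_integral_mult_right set_integral_diff(2)[OF int_c int_g] int_c01 by simp
  moreover have int_1: "set_integrable lborel {0..1} (\<lambda>q. (a - ?g q) / (?g q)\<^sup>2)"
  proof -
    have "set_integrable lborel {0..1} (\<lambda>q. a * (1 / ?g q ^ 2) - 1 / ?g q ^ 1)"
      by (intro set_integral_diff(1) set_integrable_mult_right set_integrable_tail_power[OF fin])
    also have "(\<lambda>q. a * (1 / ?g q ^ 2) - 1 / ?g q ^ 1) = (\<lambda>q. (a - ?g q) / (?g q)\<^sup>2)"
      using g by (auto simp: fun_eq_iff field_simps power2_eq_square less_imp_neq[symmetric])
    finally show ?thesis .
  qed
  moreover have int_2: "set_integrable lborel {0..1} (\<lambda>q. 2 * (a - ?g q))"
    by (intro set_integrable_mult_right set_integral_diff(1) int_c int_g)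
  ultimately have le: "(LINT q:{0..1}|lborel. (a - ?g q) / (?g q)\<^sup>2 - 2 * (a - ?g q)) \<le> 0"
    by (simp add: set_integral_diff(2)[OF int_1 int_2])
  have eq: "(a - x) / x\<^sup>2 - 2 * (a - x) = 2 * (a - x)\<^sup>2 * (a + x) / x\<^sup>2" if "0 < x" for x
  proof -
    have "(a - x) - 2 * (a - x) * x\<^sup>2 = 2 * (a - x) * (a\<^sup>2 - x\<^sup>2)"
      using a by (simp add: algebra_simps)
    also have "\<dots> = 2 * (a - x)\<^sup>2 * (a + x)"
      by (simp add: power2_eq_square algebra_simps)
    finally show ?thesis
      using that by (simp add: field_simps)
  qed
  \<comment> \<open>Compare \<open>g\<close> with \<open>a\<close> at the midpoint of \<open>(s,1)\<close>: strict monotonicity excludes the value \<open>a\<close> on one half.\<close>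
  define m where "m = (s + 1) / 2"
  have m: "s < m" "m < 1"
    using s by (simp_all add: m_def)
  have strict: "?g r < ?g q" if "s \<le> q" "q < r" "r \<le> 1" for q r
  proof -
    have "0 < (LINT t:{q..<r}|lborel. \<gamma> t)"
    proof (rule set_integral_pos[where a=q and b=r])
      show "set_integrable lborel {q..<r} \<gamma>"
        using that s by (intro set_integrable_subset[OF finD(4)]) auto
      show "0 < \<gamma> t" if "q < t" "t < r" for t
        using finD(2)[of s t] \<gamma>s s that \<open>s \<le> q\<close> \<open>r \<le> 1\<close> by simp
      show "0 \<le> \<gamma> t" if "t \<in> {q..<r}" for t
        using finD(1)[of t] s that \<open>s \<le> q\<close> \<open>r \<le> 1\<close> by simp
    qed (use that in auto)
    then show ?thesis
      using tail_split[OF fin, of q r] that s by simp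
  qed
  obtain b c where bc: "0 \<le> b" "b < c" "c \<le> 1" "\<And>q. b < q \<Longrightarrow> q < c \<Longrightarrow> ?g q \<noteq> a"
  proof (cases "?g m \<le> a")
    case True
    then have "?g q \<noteq> a" if "m < q" "q < 1" for q
      using strict[of m q] that m by simp
    then show ?thesis
      using that[of m 1] m s by simp
  next
    case False
    then have "?g q \<noteq> a" if "s < q" "q < m" for q
      using strict[of q m] that m by simp
    then show ?thesis
      using that[of s m] m s by simp
  qed
  have "0 < (LINT q:{0..1}|lborel. (a - ?g q) / (?g q)\<^sup>2 - 2 * (a - ?g q))"
  proof (rule set_integral_pos[OF set_integral_diff(1)[OF int_1 int_2] _ bc(2)])
    show "0 \<le> (a - ?g q) / (?g q)\<^sup>2 - 2 * (a - ?g q)" for q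
      unfolding eq[OF g] using a g[of q] by (intro divide_nonneg_pos) auto
    show "0 < (a - ?g q) / (?g q)\<^sup>2 - 2 * (a - ?g q)" if "b < q" "q < c" for q
      unfolding eq[OF g] using a g[of q] bc(4)[OF that] by (intro divide_pos_pos mult_pos_pos) auto
  qed (use bc in auto)
  then show False
    using le by simp
qed

text \<open>If the slope were negative at the edge \<open>s\<^sub>0\<close>, it would be negative on a neighbourhood
  \<open>(s\<^sub>0 - e, s\<^sub>0 + e)\<close>. Raising \<open>\<gamma>\<close> there to the constant \<open>\<gamma> (s\<^sub>0 + e)\<close> keeps it monotone and
  decreases the energy. If \<open>s\<^sub>0 = 1\<close>, the mass at stake is the atom, and enlarging \<open>\<Delta>\<close> replaces raising \<open>\<gamma>\<close>.\<close>

lemma slope_nonneg_at_edge: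
  assumes s0: "0 < s0" "s0 \<le> 1"
    and zero: "\<And>s. 0 \<le> s \<Longrightarrow> s < s0 \<Longrightarrow> \<gamma> s = 0"
    and pos: "\<And>s. s0 < s \<Longrightarrow> s < 1 \<Longrightarrow> 0 < \<gamma> s"
  shows "0 \<le> slope s0"
proof (cases "s0 = 1")
  case True
  have "finite_admissible \<gamma> (\<Delta> + 1)"
    using finite_admissible_mass[OF fin] finD(3) by simp
  then show ?thesis
    using slope_inequality[of \<gamma> "\<Delta> + 1"] True by simp
next
  case False
  then have s01: "s0 < 1"
    using s0 by simp
  show ?thesis
  proof (rule ccontr)
    assume "\<not> 0 \<le> slope s0"
    moreover have "isCont slope s0"
      using continuous_on_interior[OF continuous_on_slope, of s0] s0 s01 by simp
    then have "(slope \<longlongrightarrow> slope s0) (nhds s0)"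
      by (simp add: continuous_at tendsto_at_iff_tendsto_nhds)
    ultimately have "\<forall>\<^sub>F s in nhds s0. slope s < 0"
      by (intro order_tendstoD(2)) auto
    then obtain d where d: "0 < d" "\<And>s. \<bar>s - s0\<bar> < d \<Longrightarrow> slope s < 0"
      unfolding eventually_nhds_metric by (auto simp: dist_real_def)
    define e where "e = min d (min s0 (1 - s0)) / 2"
    have e: "0 < e" "e < d" "e < s0" "e < 1 - s0"
      using d(1) s0 s01 by (auto simp: e_def min_def)
    define \<gamma>' where "\<gamma>' s = (if s < s0 + e then if s < s0 - e then 0 else \<gamma> (s0 + e) else \<gamma> s)" for s
    have \<gamma>e: "0 < \<gamma> (s0 + e)"
      using e by (intro pos) auto
    have fin': "finite_admissible \<gamma>' \<Delta>"
      unfolding \<gamma>'_def using e s0 \<gamma>e finD(3)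
      by (intro finite_admissible_if finite_admissible_const fin) (auto intro!: finD(1,2))
    show False
    proof (rule no_descent_direction[OF fin', of "s0 - e" s0])
      show "slope s * (\<gamma>' s - \<gamma> s) \<le> 0" if "0 \<le> s" "s < 1" for s
      proof -
        consider "s < s0 - e" | "s0 - e \<le> s" "s < s0 + e" | "s0 + e \<le> s" by linarith
        then show ?thesis
        proof cases
          case 1
          then show ?thesis using e that by (simp add: \<gamma>'_def zero)
        next
          case 2
          then have "slope s < 0" "\<gamma> s \<le> \<gamma> (s0 + e)"
            using e that by (auto intro!: d(2) finD(2))
          then show ?thesis using 2 by (simp add: \<gamma>'_def mult_nonpos_nonneg)
        qed (simp add: \<gamma>'_def)
      qed
      show "slope s * (\<gamma>' s - \<gamma> s) < 0" if "s0 - e < s" "s < s0" for s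
        using d(2)[of s] e that \<gamma>e by (auto simp: \<gamma>'_def zero intro: mult_neg_pos)
    qed (use e s0 in auto)
  qed
qed

text \<open>Spreading mass evenly: let \<open>s\<^sub>1\<close> lie slightly above \<open>s\<^sub>0\<close> and replace \<open>\<gamma>\<close> on \<open>[0,s\<^sub>1)\<close> by its mean
  \<open>m\<close>. The old mass sat in \<open>[s\<^sub>0,s\<^sub>1)\<close>, where the slope is nearly \<open>slope s\<^sub>0\<close>, while the new mass sees the mean
  of the slope over \<open>[0,s\<^sub>1)\<close>. If the latter were smaller, the energy would go down. If \<open>s\<^sub>0 = 1\<close>, half of
  the atom is spread over \<open>[0,1)\<close> instead.\<close>

lemma edge_slope_le_average:
  assumes s0: "0 < s0" "s0 \<le> 1"
    and zero: "\<And>s. 0 \<le> s \<Longrightarrow> s < s0 \<Longrightarrow> \<gamma> s = 0"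
    and pos: "\<And>s. s0 < s \<Longrightarrow> s < 1 \<Longrightarrow> 0 < \<gamma> s"
  shows "s0 * slope s0 \<le> integral {0..s0} slope"
proof (cases "s0 = 1")
  case True
  have fin': "finite_admissible (\<lambda>_. \<Delta> / 2) (\<Delta> / 2)"
    using finD(3) by (intro finite_admissible_const) auto
  have "(LINT s:{0..<1}|lborel. slope s * (\<Delta> / 2 - \<gamma> s)) = (LINT s:{0..<1}|lborel. slope s * (\<Delta> / 2))"
    using zero True unfolding set_lebesgue_integral_def
    by (intro Bochner_Integration.integral_cong) (auto simp: indicator_def)
  also have "\<dots> = integral {0..1} slope * (\<Delta> / 2)"
    unfolding set_integral_mult_left set_integral_Ico_eq_integral(1)[OF continuous_on_slope] ..
  finally have "0 \<le> (integral {0..1} slope - slope 1) * (\<Delta> / 2)"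
    using slope_inequality[OF fin'] by (simp add: algebra_simps)
  then show ?thesis
    using True finD(3) by (simp add: zero_le_mult_iff)
next
  case False
  then have s01: "s0 < 1"
    using s0 by simp
  show ?thesis
  proof (rule ccontr)
    assume "\<not> ?thesis"
    then have "integral {0..s0} slope / s0 < slope s0"
      using s0 by (simp add: divide_less_eq mult.commute)
    \<comment> \<open>The value \<open>c\<close> separates the mean from the edge value, also after a small shift of \<open>s0\<close>.\<close>
    then obtain c where c: "integral {0..s0} slope / s0 < c" "c < slope s0"
      using dense by blast
    define I where "I s = integral {0..s} slope - c * s" for s
    have "continuous_on {0..1} I"
      unfolding I_def
      by (intro continuous_intros indefinite_integral_continuous_1 integrable_continuous_interval
          continuous_on_slope)
    then have "isCont I s0" "isCont slope s0"
      using continuous_on_interior[of "{0..1}" I s0] continuous_on_interior[OF continuous_on_slope, of s0]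
        s0 s01 by simp_all
    then have "(I \<longlongrightarrow> I s0) (nhds s0)" "(slope \<longlongrightarrow> slope s0) (nhds s0)"
      by (simp_all add: continuous_at tendsto_at_iff_tendsto_nhds)
    moreover have "I s0 < 0"
      using c(1) s0 by (simp add: I_def divide_less_eq)
    ultimately have "\<forall>\<^sub>F s in nhds s0. I s < 0" "\<forall>\<^sub>F s in nhds s0. c < slope s"
      using c(2) by (auto intro: order_tendstoD)
    then have "\<forall>\<^sub>F s in nhds s0. I s < 0 \<and> c < slope s"
      by (rule eventually_conj)
    then obtain d where d: "0 < d" "\<And>s. \<bar>s - s0\<bar> < d \<Longrightarrow> I s < 0 \<and> c < slope s"
      unfolding eventually_nhds_metric by (auto simp: dist_real_def)
    obtain e where e: "0 < e" "e \<le> d" "e \<le> 1 - s0"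
      using d(1) s01 that[of "min d (1 - s0)"] by auto
    define s1 where "s1 = s0 + e / 2"
    have s1: "s0 < s1" "s1 < 1" "s1 < s0 + d"
      unfolding s1_def using e d(1) s01 by simp_all
    define m where "m = (LINT s:{0..<s1}|lborel. \<gamma> s) / s1"
    have int_\<gamma>: "set_integrable lborel {0..<s1} \<gamma>"
      using s1 by (intro set_integrable_subset[OF finD(4)]) auto
    have int_c: "set_integrable lborel {0..<s1} (\<lambda>_. r :: real)" for r
      by (rule set_integral_Ico_eq_integral(2)) simp
    have int_m: "(LINT s:{0..<s1}|lborel. \<gamma> s) = m * s1"
      using s0 s1 by (simp add: m_def)
    have "0 < m * s1"
      unfolding int_m[symmetric]
      by (rule set_integral_pos[OF int_\<gamma> _ s1(1)]) (use s0 s1 in \<open>auto intro!: finD(1) pos\<close>)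
    then have m: "0 < m"
      using s0 s1 by (simp add: zero_less_mult_iff)
    have "m * s1 \<le> (LINT s:{0..<s1}|lborel. \<gamma> s1)"
      unfolding int_m[symmetric]
      by (rule set_integral_mono[OF int_\<gamma> int_c]) (use s1 in \<open>auto intro!: finD(2)\<close>)
    also have "\<dots> = \<gamma> s1 * s1"
      using s0 s1 by (simp add: set_lebesgue_integral_def)
    finally have m_le: "m \<le> \<gamma> s1"
      using s0 s1 by simp
    define \<gamma>' where "\<gamma>' s = (if s < s1 then m else \<gamma> s)" for s
    have fin': "finite_admissible \<gamma>' \<Delta>"
      unfolding \<gamma>'_def using m finD(3) s0 s1
      by (intro finite_admissible_if finite_admissible_const fin) (auto intro!: order_trans[OF m_le] finD(2))
    have slope_cont: "continuous_on {0..s1} slope"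
      using s1 by (intro continuous_on_subset[OF continuous_on_slope]) auto
    have int_sm: "set_integrable lborel {0..<s1} (\<lambda>s. slope s * m)"
      by (intro set_integrable_mult_left set_integral_Ico_eq_integral(2)[OF slope_cont])
    have int_s\<gamma>: "set_integrable lborel {0..<s1} (\<lambda>s. slope s * \<gamma> s)"
      using s1 by (intro set_integrable_subset[OF set_integrable_continuous_mult[OF finD(4) continuous_on_slope]]) auto
    have "0 \<le> (LINT s:{0..<1}|lborel. slope s * (\<gamma>' s - \<gamma> s))"
      using slope_inequality[OF fin'] by simp
    also have "\<dots> = (LINT s:{0..<s1}|lborel. slope s * m - slope s * \<gamma> s)"
      using s1 unfolding set_lebesgue_integral_def
      by (intro Bochner_Integration.integral_cong) (auto simp: indicator_def \<gamma>'_def algebra_simps)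
    also have "\<dots> = integral {0..s1} slope * m - (LINT s:{0..<s1}|lborel. slope s * \<gamma> s)"
      unfolding set_integral_diff(2)[OF int_sm int_s\<gamma>] set_integral_mult_left
        set_integral_Ico_eq_integral(1)[OF slope_cont] ..
    also have "\<dots> \<le> integral {0..s1} slope * m - c * (m * s1)"
    proof -
      have "(LINT s:{0..<s1}|lborel. c * \<gamma> s) \<le> (LINT s:{0..<s1}|lborel. slope s * \<gamma> s)"
      proof (rule set_integral_mono)
        fix s assume s: "s \<in> {0..<s1}"
        show "c * \<gamma> s \<le> slope s * \<gamma> s"
        proof (cases "s < s0")
          case False
          then have "c < slope s"
            using d(2)[of s] s s1 by simp
          then show ?thesis
            using s s1 by (intro mult_right_mono finD(1)) auto
        qed (use s in \<open>simp add: zero\<close>)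
      qed (use int_\<gamma> int_s\<gamma> in auto)
      then show ?thesis
        by (simp add: int_m)
    qed
    also have "\<dots> = I s1 * m"
      by (simp add: I_def algebra_simps)
    finally have "0 \<le> I s1"
      using m by (simp add: zero_le_mult_iff)
    then show False
      using d(2)[of s1] s1 by simp
  qed
qed

lemma slope_flat:
  assumes s0: "s0 \<le> 1" and zero: "\<And>s. 0 \<le> s \<Longrightarrow> s < s0 \<Longrightarrow> \<gamma> s = 0" and s: "0 \<le> s" "s \<le> s0"
  shows "slope s = k s - s / (tail \<gamma> \<Delta> s0)\<^sup>2"
proof -
  have "tail \<gamma> \<Delta> q = tail \<gamma> \<Delta> s0" if "0 \<le> q" "q \<le> s" for q
  proof -
    have "(LINT t:{q..<s0}|lborel. \<gamma> t) = (LINT t:{q..<s0}|lborel. 0)"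
      unfolding set_lebesgue_integral_def
      by (intro Bochner_Integration.integral_cong) (use that zero in \<open>auto simp: indicator_def\<close>)
    then show ?thesis
      using tail_split[OF fin, of q s0] that s s0 by (simp add: set_lebesgue_integral_def)
  qed
  then have "(LINT q:{0..s}|lborel. 1 / (tail \<gamma> \<Delta> q)\<^sup>2) = (LINT q:{0..s}|lborel. 1 / (tail \<gamma> \<Delta> s0)\<^sup>2)"
    unfolding set_lebesgue_integral_def
    by (intro Bochner_Integration.integral_cong) (auto simp: indicator_def)
  also have "\<dots> = s / (tail \<gamma> \<Delta> s0)\<^sup>2"
    using s by (simp add: set_lebesgue_integral_def)
  finally show ?thesis
    by (simp add: slope_def)
qed

text \<open>Suppose that \<open>\<gamma>\<close> vanishes up to \<open>s\<^sub>0\<close>. With \<open>b = 1/g(s\<^sub>0)\<^sup>2\<close> the integral of the slope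
  over \<open>[0,s\<^sub>0]\<close> is \<open>K s\<^sub>0 - b s\<^sub>0\<^sup>2/2\<close>, while \<open>s\<^sub>0 slope s\<^sub>0 = s\<^sub>0 k s\<^sub>0 - b s\<^sub>0\<^sup>2\<close>. The quadratic terms
  cancel when the first is doubled, so twice the integral is strictly below \<open>s\<^sub>0 slope s\<^sub>0\<close>. The two lemmas on
  the edge exclude this.\<close>

lemma positive_if_superquadratic:
  assumes K: "\<And>s. 0 \<le> s \<Longrightarrow> s \<le> 1 \<Longrightarrow> (K has_real_derivative k s) (at s)" "K 0 = 0"
    and super: "\<And>s. 0 < s \<Longrightarrow> s \<le> 1 \<Longrightarrow> 2 * K s < s * k s"
    and s: "0 < s" "s < 1"
  shows "\<gamma> s \<noteq> 0"
proof
  assume \<gamma>s: "\<gamma> s = 0"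
  define Z where "Z = {z. 0 \<le> z \<and> z < 1 \<and> \<gamma> z = 0}"
  define s0 where "s0 = Sup Z"
  have Z: "s \<in> Z" "bdd_above Z"
    using s \<gamma>s by (auto simp: Z_def intro!: bdd_aboveI[of _ 1])
  have s0: "0 < s0" "s0 \<le> 1"
  proof -
    show "0 < s0"
      using cSup_upper[OF Z] s by (simp add: s0_def)
    show "s0 \<le> 1"
      unfolding s0_def using Z(1) by (intro cSup_least) (auto simp: Z_def)
  qed
  have zero: "\<gamma> z = 0" if z: "0 \<le> z" "z < s0" for z
  proof -
    obtain y where "y \<in> Z" "z < y"
      using z less_cSup_iff[of Z z] Z by (auto simp: s0_def)
    then show ?thesis
      using finD(2)[of z y] finD(1)[of z] z by (auto simp: Z_def)
  qed
  have pos: "0 < \<gamma> z" if "s0 < z" "z < 1" for z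
  proof -
    have "z \<notin> Z"
      using cSup_upper[of z Z] Z that by (auto simp: s0_def)
    then show ?thesis
      using finD(1)[of z] that s0 by (auto simp: Z_def)
  qed
  define b where "b = 1 / (tail \<gamma> \<Delta> s0)\<^sup>2"
  have slope: "slope s = k s - b * s" if "0 \<le> s" "s \<le> s0" for s
    using slope_flat[OF s0(2) zero that] by (simp add: b_def)
  have "((\<lambda>s. k s - b * s) has_integral ((K s0 - b * s0\<^sup>2 / 2) - (K 0 - b * 0\<^sup>2 / 2))) {0..s0}"
    using s0
    by (intro fundamental_theorem_of_calculus)
      (auto simp: has_real_derivative_iff_has_vector_derivative[symmetric]
        intro!: derivative_eq_intros has_field_derivative_at_within[OF K(1)])
  then have "integral {0..s0} (\<lambda>s. k s - b * s) = K s0 - b * s0\<^sup>2 / 2"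
    using K(2) by (simp add: integral_unique)
  moreover have "integral {0..s0} slope = integral {0..s0} (\<lambda>s. k s - b * s)"
    using slope by (intro Henstock_Kurzweil_Integration.integral_cong) auto
  moreover have "s0 * slope s0 = s0 * k s0 - b * s0\<^sup>2"
    using s0 by (simp add: slope power2_eq_square right_diff_distrib)
  ultimately have "2 * integral {0..s0} slope < s0 * slope s0"
    using super[OF s0] by (simp add: field_simps)
  moreover have "s0 * slope s0 \<le> integral {0..s0} slope" "0 \<le> s0 * slope s0"
    using edge_slope_le_average[OF s0 zero pos] slope_nonneg_at_edge[OF s0 zero pos] s0 by auto
  ultimately show False
    by linarith
qed

end


section \<open>The functional as an energy\<close>

lemma admissible_measurable:
  assumes "admissible \<gamma> \<Delta>"
  shows "set_borel_measurable borel {0..<1} \<gamma>"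
proof -
  have "\<gamma> \<in> borel_measurable (restrict_space borel {0..<1})"
    using assms by (intro borel_measurable_mono_on_fnc) (simp add: admissible_def)
  then show ?thesis
    by (simp add: set_borel_measurable_def borel_measurable_restrict_space_iff)
qed

text \<open>On \<open>[0,1)\<close> the measure \<open>\<nu>\<close> coincides with the one of density \<open>\<gamma>\<close>, so it suffices to split
  off the point 1. The formula also covers infinite \<open>\<nu>\<close>, and so serves to show that a minimizer is
  finite.\<close>

lemma nn_integral_nu:
  assumes adm: "admissible \<gamma> \<Delta>" and k: "continuous_on {0..1} k"
  shows "(\<integral>\<^sup>+s. ennreal (k s) \<partial>nu \<gamma> \<Delta>) =
    (\<integral>\<^sup>+s\<in>{0..<1}. ennreal (\<gamma> s) * ennreal (k s) \<partial>lborel) + ennreal \<Delta> * ennreal (k 1)"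
proof -
  let ?w = "\<lambda>s. ennreal (\<gamma> s) * indicator {0..<1} s"
  have w: "?w \<in> borel_measurable lborel"
  proof -
    have "(\<lambda>s. ennreal (indicator {0..<1} s *\<^sub>R \<gamma> s)) \<in> borel_measurable lborel"
      using admissible_measurable[OF adm] by (simp add: set_borel_measurable_def)
    also have "(\<lambda>s. ennreal (indicator {0..<1} s *\<^sub>R \<gamma> s)) = ?w"
      by (auto simp: fun_eq_iff indicator_def)
    finally show ?thesis .
  qed
  have k_ind: "(\<lambda>s. ennreal (k s) * indicator A s) \<in> borel_measurable borel"
    if "A \<subseteq> {0..1}" "A \<in> sets borel" for A
  proof -
    have "(\<lambda>s. ennreal (indicator A s *\<^sub>R k s)) \<in> borel_measurable borel"
      using borel_measurable_continuous_on_indicator[OF that(2) continuous_on_subset[OF k that(1)]]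
      by simp
    also have "(\<lambda>s. ennreal (indicator A s *\<^sub>R k s)) = (\<lambda>s. ennreal (k s) * indicator A s)"
      by (auto simp: fun_eq_iff indicator_def)
    finally show ?thesis .
  qed
  have sub: "{0..<1} \<inter> space (nu \<gamma> \<Delta>) \<in> sets (nu \<gamma> \<Delta>)"
    "{0..<1} \<inter> space (density lborel ?w) \<in> sets (density lborel ?w)"
    by (simp_all add: space_nu sets_nu sets_restrict_space_iff)
  have restrict: "restrict_space (nu \<gamma> \<Delta>) {0..<1} = restrict_space (density lborel ?w) {0..<1}"
  proof (rule measure_eqI)
    show sets: "sets (restrict_space (nu \<gamma> \<Delta>) {0..<1}) = sets (restrict_space (density lborel ?w) {0..<1})"
    proof -
      have "sets (restrict_space (nu \<gamma> \<Delta>) {0..<1}) = sets (restrict_space (restrict_space borel {0..1}) {0..<1::real})"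
        by (intro sets_restrict_space_cong sets_nu)
      also have "\<dots> = sets (restrict_space borel ({0..1} \<inter> {0..<1::real}))"
        by (subst restrict_restrict_space) auto
      also have "{0..1} \<inter> {0..<1::real} = {0..<1}"
        by auto
      also have "sets (restrict_space borel {0..<1::real}) = sets (restrict_space (density lborel ?w) {0..<1})"
        by (intro sets_restrict_space_cong) simp
      finally show ?thesis .
    qed
    fix A assume "A \<in> sets (restrict_space (nu \<gamma> \<Delta>) {0..<1})"
    then have "A \<in> sets (restrict_space (density lborel ?w) {0..<1})"
      by (simp only: sets)
    then have A: "A \<subseteq> {0..<1}" "A \<in> sets borel"
      by (auto simp: sets_restrict_space)
    have "A \<in> sets (restrict_space borel {0..1})"
      using A by (subst sets_restrict_space_iff) auto
    then have "emeasure (restrict_space (nu \<gamma> \<Delta>) {0..<1}) A =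
        (\<integral>\<^sup>+s\<in>A \<inter> {0..<1}. ennreal (\<gamma> s) \<partial>lborel) + ennreal \<Delta> * indicator A 1"
      using A sub by (simp add: emeasure_restrict_space emeasure_nu[OF adm])
    also have "\<dots> = (\<integral>\<^sup>+s\<in>A. ?w s \<partial>lborel)"
      using A by (auto intro!: nn_integral_cong simp: indicator_def)
    also have "\<dots> = emeasure (restrict_space (density lborel ?w) {0..<1}) A"
      using A sub w by (simp add: emeasure_restrict_space emeasure_density)
    finally show "emeasure (restrict_space (nu \<gamma> \<Delta>) {0..<1}) A =
        emeasure (restrict_space (density lborel ?w) {0..<1}) A" .
  qed
  have meas_nu: "(\<lambda>s. ennreal (k s) * indicator A s) \<in> borel_measurable (nu \<gamma> \<Delta>)"
    if "A \<subseteq> {0..1}" "A \<in> sets borel" for A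
    using measurable_restrict_space1[OF k_ind[OF that]] measurable_cong_sets[OF sets_nu refl] by blast
  have "(\<integral>\<^sup>+s. ennreal (k s) \<partial>nu \<gamma> \<Delta>) =
      (\<integral>\<^sup>+s. ennreal (k s) * indicator {0..<1} s + ennreal (k s) * indicator {1} s \<partial>nu \<gamma> \<Delta>)"
    by (rule nn_integral_cong) (auto simp: space_nu indicator_def)
  also have "\<dots> = (\<integral>\<^sup>+s\<in>{0..<1}. ennreal (k s) \<partial>nu \<gamma> \<Delta>) + (\<integral>\<^sup>+s\<in>{1}. ennreal (k s) \<partial>nu \<gamma> \<Delta>)"
    by (intro nn_integral_add meas_nu) auto
  also have "(\<integral>\<^sup>+s\<in>{0..<1}. ennreal (k s) \<partial>nu \<gamma> \<Delta>) = (\<integral>\<^sup>+s\<in>{0..<1}. ennreal (k s) \<partial>density lborel ?w)"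
    using nn_integral_restrict_space[OF sub(1)] nn_integral_restrict_space[OF sub(2)] restrict by metis
  also have "\<dots> = (\<integral>\<^sup>+s. ?w s * (ennreal (k s) * indicator {0..<1} s) \<partial>lborel)"
    using k_ind[of "{0..<1}"] by (intro nn_integral_density w) (simp add: subset_iff)
  also have "\<dots> = (\<integral>\<^sup>+s\<in>{0..<1}. ennreal (\<gamma> s) * ennreal (k s) \<partial>lborel)"
    by (rule nn_integral_cong) (auto simp: indicator_def)
  also have "(\<integral>\<^sup>+s\<in>{1}. ennreal (k s) \<partial>nu \<gamma> \<Delta>) = (\<integral>\<^sup>+s\<in>{1}. ennreal (k 1) \<partial>nu \<gamma> \<Delta>)"
    by (rule nn_integral_cong) (auto simp: indicator_def)
  also have "\<dots> = ennreal (k 1) * emeasure (nu \<gamma> \<Delta>) {1}"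
    by (rule nn_integral_cmult_indicator) (auto simp: sets_nu sets_restrict_space_iff)
  also have "emeasure (nu \<gamma> \<Delta>) {1} = ennreal \<Delta>"
    by (subst emeasure_nu[OF adm]) (auto simp: sets_restrict_space_iff)
  finally show ?thesis
    by (simp add: mult.commute)
qed

lemma emeasure_nu_Ioc:
  assumes fin: "finite_admissible \<gamma> \<Delta>" and q: "0 \<le> q" "q < 1"
  shows "emeasure (nu \<gamma> \<Delta>) {q<..1} = ennreal (tail \<gamma> \<Delta> q)"
proof -
  have adm: "admissible \<gamma> \<Delta>"
    using fin by (simp add: finite_admissible_def)
  have "emeasure (nu \<gamma> \<Delta>) {q<..1} =
      (\<integral>\<^sup>+s\<in>{q<..1} \<inter> {0..<1}. ennreal (\<gamma> s) \<partial>lborel) + ennreal \<Delta> * indicator {q<..1} 1"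
    by (rule emeasure_nu[OF adm]) (use q in \<open>auto simp: sets_restrict_space_iff\<close>)
  also have "(\<integral>\<^sup>+s\<in>{q<..1} \<inter> {0..<1}. ennreal (\<gamma> s) \<partial>lborel) =
      (\<integral>\<^sup>+s. ennreal (indicator {max 0 q..<1} s *\<^sub>R \<gamma> s) \<partial>lborel)"
  proof (rule nn_integral_cong_AE)
    show "AE s in lborel. ennreal (\<gamma> s) * indicator ({q<..1} \<inter> {0..<1}) s =
        ennreal (indicator {max 0 q..<1} s *\<^sub>R \<gamma> s)"
      using AE_lborel_singleton[of q] by eventually_elim (use q in \<open>auto simp: indicator_def\<close>)
  qed
  also have "\<dots> = ennreal (LINT s:{max 0 q..<1}|lborel. \<gamma> s)"
    using set_integrable_tail[OF finite_admissibleD(4)[OF fin], of q] finite_admissibleD(1)[OF fin]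
    unfolding set_lebesgue_integral_def set_integrable_def
    by (intro nn_integral_eq_integral) (auto simp: indicator_def)
  also have "ennreal (LINT s:{max 0 q..<1}|lborel. \<gamma> s) + ennreal \<Delta> * indicator {q<..1} 1 =
      ennreal (tail \<gamma> \<Delta> q)"
  proof -
    have "0 \<le> (LINT s:{max 0 q..<1}|lborel. \<gamma> s)"
      using tail_ge[OF fin, of q] by (simp add: tail_def)
    then show ?thesis
      using q finite_admissibleD(3)[OF fin] by (simp add: tail_def ennreal_plus add.commute)
  qed
  finally show ?thesis .
qed

lemma energy_nonneg:
  assumes fin: "finite_admissible \<gamma> \<Delta>" and k: "\<And>s. 0 \<le> s \<Longrightarrow> s \<le> 1 \<Longrightarrow> 0 \<le> k s"
  shows "0 \<le> (LINT s:{0..<1}|lborel. k s * \<gamma> s)" "0 \<le> (LINT q:{0..1}|lborel. 1 / tail \<gamma> \<Delta> q)"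
    "0 \<le> energy k \<gamma> \<Delta>"
proof -
  show 1: "0 \<le> (LINT s:{0..<1}|lborel. k s * \<gamma> s)"
    unfolding set_lebesgue_integral_def
    using k finite_admissibleD(1)[OF fin] by (intro integral_nonneg_AE AE_I2) (auto simp: indicator_def)
  show 2: "0 \<le> (LINT q:{0..1}|lborel. 1 / tail \<gamma> \<Delta> q)"
    unfolding set_lebesgue_integral_def
    using tail_pos[OF fin] by (intro integral_nonneg_AE AE_I2) (auto simp: less_imp_le)
  show "0 \<le> energy k \<gamma> \<Delta>"
    using 1 2 k[of 1] finite_admissibleD(3)[OF fin] by (simp add: energy_def)
qed

lemma Q_functional_eq_energy:
  assumes fin: "finite_admissible \<gamma> \<Delta>" and k_cont: "continuous_on {0..1} (\<lambda>s. deriv (xi c) s + h\<^sup>2)"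
    and k0: "\<And>s. 0 \<le> s \<Longrightarrow> s \<le> 1 \<Longrightarrow> 0 \<le> deriv (xi c) s + h\<^sup>2"
  shows "Q_functional c h (nu \<gamma> \<Delta>) = 1 / 2 * ennreal (energy (\<lambda>s. deriv (xi c) s + h\<^sup>2) \<gamma> \<Delta>)"
proof -
  define k where "k s = deriv (xi c) s + h\<^sup>2" for s
  have k_cont: "continuous_on {0..1} k" and k0: "\<And>s. 0 \<le> s \<Longrightarrow> s \<le> 1 \<Longrightarrow> 0 \<le> k s"
    using k_cont k0 by (simp_all add: k_def[abs_def])
  note finD = finite_admissibleD[OF fin] and nonneg = energy_nonneg[OF fin k0]
  have adm: "admissible \<gamma> \<Delta>"
    using fin by (simp add: finite_admissible_def)
  have "(\<integral>\<^sup>+s\<in>{0..<1}. ennreal (\<gamma> s) * ennreal (k s) \<partial>lborel) =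
      (\<integral>\<^sup>+s. ennreal (indicator {0..<1} s *\<^sub>R (k s * \<gamma> s)) \<partial>lborel)"
    using finD(1) k0 by (intro nn_integral_cong) (auto simp: indicator_def ennreal_mult mult.commute)
  also have "\<dots> = ennreal (LINT s:{0..<1}|lborel. k s * \<gamma> s)"
    using set_integrable_continuous_mult[OF finD(4) k_cont] finD(1) k0
    unfolding set_lebesgue_integral_def set_integrable_def
    by (intro nn_integral_eq_integral) (auto simp: indicator_def)
  finally have 1: "(\<integral>\<^sup>+s. ennreal (k s) \<partial>nu \<gamma> \<Delta>) =
      ennreal ((LINT s:{0..<1}|lborel. k s * \<gamma> s) + k 1 * \<Delta>)"
    unfolding nn_integral_nu[OF adm k_cont]
    using nonneg k0[of 1] finD(3) by (simp add: ennreal_plus ennreal_mult mult.commute)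
  have "(\<integral>\<^sup>+q\<in>{0..1}. 1 / emeasure (nu \<gamma> \<Delta>) {q<..1} \<partial>lborel) =
      (\<integral>\<^sup>+q. ennreal (indicator {0..1} q *\<^sub>R (1 / tail \<gamma> \<Delta> q)) \<partial>lborel)"
  proof (rule nn_integral_cong_AE)
    have eq: "1 / emeasure (nu \<gamma> \<Delta>) {q<..1} = ennreal (1 / tail \<gamma> \<Delta> q)" if "0 \<le> q" "q < 1" for q
      using emeasure_nu_Ioc[OF fin that] tail_pos[OF fin, of q] divide_ennreal[of 1 "tail \<gamma> \<Delta> q"]
      by simp
    show "AE q in lborel. 1 / emeasure (nu \<gamma> \<Delta>) {q<..1} * indicator {0..1} q =
        ennreal (indicator {0..1} q *\<^sub>R (1 / tail \<gamma> \<Delta> q))"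
      using AE_lborel_singleton[of 1] by eventually_elim (auto simp: eq indicator_def)
  qed
  also have "\<dots> = ennreal (LINT q:{0..1}|lborel. 1 / tail \<gamma> \<Delta> q)"
    using set_integrable_tail_power[OF fin, of 0 1 1] tail_pos[OF fin]
    unfolding set_lebesgue_integral_def set_integrable_def
    by (intro nn_integral_eq_integral) (auto simp: less_imp_le)
  finally have 2: "(\<integral>\<^sup>+q\<in>{0..1}. 1 / emeasure (nu \<gamma> \<Delta>) {q<..1} \<partial>lborel) =
      ennreal (LINT q:{0..1}|lborel. 1 / tail \<gamma> \<Delta> q)" .
  show ?thesis
    using nonneg k0[of 1] finD(3)
    unfolding Q_functional_def k_def[symmetric] 1 2 energy_def
    by (subst ennreal_plus[symmetric]) auto
qed

text \<open>The weight \<open>k\<close> may vanish at 0, so it controls \<open>\<gamma>\<close> only on \<open>[1/2,1)\<close>, where it has a positive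
  minimum. On \<open>[0,1/2)\<close> monotonicity bounds \<open>\<gamma>\<close> by \<open>\<gamma>(1/2)\<close>.\<close>

lemma admissible_finite_if_nn_integral_finite:
  assumes adm: "admissible \<gamma> \<Delta>" and k_cont: "continuous_on {0..1} k"
    and k: "\<And>s. 0 < s \<Longrightarrow> s \<le> 1 \<Longrightarrow> 0 < k s"
    and int: "(\<integral>\<^sup>+s. ennreal (k s) \<partial>nu \<gamma> \<Delta>) < \<infinity>"
  shows "finite_admissible \<gamma> \<Delta>"
proof -
  have \<gamma>0: "\<And>s. 0 \<le> s \<Longrightarrow> s < 1 \<Longrightarrow> 0 \<le> \<gamma> s" and mono: "\<And>s t. 0 \<le> s \<Longrightarrow> s \<le> t \<Longrightarrow> t < 1 \<Longrightarrow> \<gamma> s \<le> \<gamma> t"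
    using adm by (auto simp: admissible_def intro: mono_onD)
  have meas: "(\<lambda>s. indicator A s *\<^sub>R \<gamma> s) \<in> borel_measurable lborel" if "A \<subseteq> {0..<1}" "A \<in> sets borel" for A
  proof -
    have "(\<lambda>s. indicator A s *\<^sub>R (indicator {0..<1} s *\<^sub>R \<gamma> s)) \<in> borel_measurable lborel"
      using admissible_measurable[OF adm] that by (simp add: set_borel_measurable_def)
    also have "(\<lambda>s. indicator A s *\<^sub>R (indicator {0..<1} s *\<^sub>R \<gamma> s)) = (\<lambda>s. indicator A s *\<^sub>R \<gamma> s)"
      using that by (auto simp: fun_eq_iff indicator_def)
    finally show ?thesis .
  qed
  obtain x where x: "x \<in> {1/2..1}" "\<And>s. s \<in> {1/2..1} \<Longrightarrow> k x \<le> k s"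
    using continuous_attains_inf[of "{1/2..1::real}" k] continuous_on_subset[OF k_cont, of "{1/2..1}"]
    by auto
  have kx: "0 < k x"
    using x(1) by (intro k) auto
  have "ennreal (k x) * (\<integral>\<^sup>+s. ennreal (indicator {1/2..<1} s *\<^sub>R \<gamma> s) \<partial>lborel) =
      (\<integral>\<^sup>+s. ennreal (k x) * ennreal (indicator {1/2..<1} s *\<^sub>R \<gamma> s) \<partial>lborel)"
    using meas[of "{1/2..<1}"] by (intro nn_integral_cmult[symmetric]) auto
  also have "\<dots> \<le> (\<integral>\<^sup>+s\<in>{0..<1}. ennreal (\<gamma> s) * ennreal (k s) \<partial>lborel)"
    using x(2) by (intro nn_integral_mono)
      (auto simp: indicator_def mult.commute intro!: mult_mono ennreal_leI)
  also have "\<dots> \<le> (\<integral>\<^sup>+s. ennreal (k s) \<partial>nu \<gamma> \<Delta>)"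
    by (simp add: nn_integral_nu[OF adm k_cont])
  finally have "ennreal (k x) * (\<integral>\<^sup>+s. ennreal (indicator {1/2..<1} s *\<^sub>R \<gamma> s) \<partial>lborel) < \<infinity>"
    using int by (rule le_less_trans)
  then have "(\<integral>\<^sup>+s. ennreal (indicator {1/2..<1} s *\<^sub>R \<gamma> s) \<partial>lborel) < \<infinity>"
    using kx by (auto simp: ennreal_mult_less_top)
  then have right: "set_integrable lborel {1/2..<1} \<gamma>"
    unfolding set_integrable_def
    using meas[of "{1/2..<1}"] \<gamma>0 by (intro integrableI_nonneg) (auto simp: indicator_def)
  have left: "set_integrable lborel {0..<1/2} \<gamma>"
    unfolding set_integrable_def
  proof (rule Bochner_Integration.integrable_bound)
    show "integrable lborel (\<lambda>s::real. indicator {0..<1/2} s *\<^sub>R \<gamma> (1/2))"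
      by (intro integrable_scaleR_left integrable_real_indicator) (auto simp: less_top[symmetric])
    show "AE s in lborel. norm (indicator {0..<1/2} s *\<^sub>R \<gamma> s) \<le> norm (indicator {0..<1/2} s *\<^sub>R \<gamma> (1/2))"
      using \<gamma>0 mono[of _ "1/2"] by (intro AE_I2) (auto simp: indicator_def)
  qed (use meas[of "{0..<1/2}"] in auto)
  have "{0..<1/2} \<union> {1/2..<1} = {0..<1::real}"
    by auto
  then have "set_integrable lborel {0..<1} \<gamma>"
    using set_integrable_Un[OF left right] by simp
  then show ?thesis
    using adm by (simp add: finite_admissible_def)
qed

lemma minimizer_is_energy_minimizer:
  fixes c h
  defines "k \<equiv> \<lambda>s. deriv (xi c) s + h\<^sup>2"
  assumes c: "mixture_coeffs c" and adm: "admissible \<gamma> \<Delta>"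
    and min: "is_arg_min (Q_functional c h) (\<lambda>\<nu>. \<nu> \<in> K_set) (nu \<gamma> \<Delta>)"
  shows "energy_minimizer k \<gamma> \<Delta>"
proof -
  have k_cont: "continuous_on {0..1} k"
    unfolding k_def by (intro continuous_intros continuous_on_deriv_xi[OF c])
  have k0: "0 \<le> k s" if "0 \<le> s" "s \<le> 1" for s
    using deriv_xi_nonneg[OF c that] by (simp add: k_def)
  have Q: "Q_functional c h (nu \<alpha> d) = 1 / 2 * ennreal (energy k \<alpha> d)" if "finite_admissible \<alpha> d" for \<alpha> d
    using Q_functional_eq_energy[OF that] k_cont k0 by (simp add: k_def)
  have le: "Q_functional c h (nu \<gamma> \<Delta>) \<le> 1 / 2 * ennreal (energy k \<alpha> d)" if "finite_admissible \<alpha> d" for \<alpha> d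
  proof -
    have "nu \<alpha> d \<in> K_set"
      using that by (auto simp: K_set_def finite_admissible_def)
    then show ?thesis
      using min Q[OF that] by (force simp: is_arg_min_def not_less)
  qed
  \<comment> \<open>Comparison with the point mass at 1 shows that the minimum is finite.\<close>
  have "finite_admissible (\<lambda>_. 0) 1"
    by (rule finite_admissible_const) auto
  from le[OF this] have "Q_functional c h (nu \<gamma> \<Delta>) < \<infinity>"
    by (rule le_less_trans) (simp add: less_top[symmetric] ennreal_mult_eq_top_iff divide_ennreal_def)
  then have "1 / 2 * (\<integral>\<^sup>+s. ennreal (k s) \<partial>nu \<gamma> \<Delta>) < \<infinity>"
    unfolding Q_functional_def k_def by (auto simp: distrib_left)
  then have "(\<integral>\<^sup>+s. ennreal (k s) \<partial>nu \<gamma> \<Delta>) < \<infinity>"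
    by (auto simp: ennreal_mult_less_top divide_ennreal_def)
  moreover have "0 < k s" if "0 < s" "s \<le> 1" for s
    using deriv_xi_pos[OF c that] by (simp add: k_def add_pos_nonneg)
  ultimately have fin: "finite_admissible \<gamma> \<Delta>"
    using adm k_cont by (intro admissible_finite_if_nn_integral_finite)
  show ?thesis
  proof
    show "energy k \<gamma> \<Delta> \<le> energy k \<gamma>' \<Delta>'" if "finite_admissible \<gamma>' \<Delta>'" for \<gamma>' \<Delta>'
    proof -
      have "1 / 2 * ennreal (energy k \<gamma> \<Delta>) \<le> 1 / 2 * ennreal (energy k \<gamma>' \<Delta>')"
        using le[OF that] Q[OF fin] by simp
      then have "2 * (1 / 2 * ennreal (energy k \<gamma> \<Delta>)) \<le> 2 * (1 / 2 * ennreal (energy k \<gamma>' \<Delta>'))"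
        by (rule mult_left_mono) simp
      then have "ennreal (energy k \<gamma> \<Delta>) \<le> ennreal (energy k \<gamma>' \<Delta>')"
        by (simp add: mult.assoc[symmetric] ennreal_times_divide)
      then show ?thesis
        using energy_nonneg(3)[OF that k0] by (simp add: ennreal_le_iff)
    qed
  qed (use k_cont fin in auto)
qed

section \<open>The left edge of the support of the Parisi measure\<close>

lemma space_parisi_measure:
  assumes "parisi_measure \<gamma> \<rho>"
  shows "space \<rho> = {0..<1}"
  using sets_eq_imp_space_eq[of \<rho> "restrict_space borel {0..<1}"] assms
  by (simp add: parisi_measure_def space_restrict_space)

lemma Gam_bounds:
  assumes "parisi_measure \<gamma> \<rho>" "s \<in> Gam \<rho>"
  shows "0 \<le> s" "s \<le> 1"
  using assms space_parisi_measure[OF assms(1)] by (auto simp: Gam_def supp_def)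

text \<open>Otherwise \<open>{..<s}\<close> would be a neighbourhood of \<open>x\<close> that is null for \<open>\<rho>\<close>, since
  \<open>\<rho>([0,s]) = \<gamma>(s)\<close>.\<close>

lemma positive_above_supp:
  assumes \<rho>: "parisi_measure \<gamma> \<rho>" and x: "x \<in> supp \<rho>" "x < s" "s < 1"
  shows "0 < \<gamma> s"
proof (rule ccontr)
  note sp = space_parisi_measure[OF \<rho>]
  assume "\<not> 0 < \<gamma> s"
  moreover have "0 \<le> s"
    using x sp by (auto simp: supp_def)
  ultimately have "emeasure \<rho> {0..s} = 0"
    using \<rho> x by (simp add: parisi_measure_def ennreal_neg)
  moreover have "{0..s} \<in> sets \<rho>"
    using \<rho> x by (auto simp: parisi_measure_def sets_restrict_space_iff)
  moreover have "{..<s} \<inter> space \<rho> \<subseteq> {0..s}"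
    using sp by auto
  ultimately have "emeasure \<rho> ({..<s} \<inter> space \<rho>) = 0"
    by (metis emeasure_mono le_zero_eq)
  then show False
    using x by (auto simp: supp_def dest!: spec[of _ "{..<s}"])
qed

lemma s_P_eq_1_if_zero:
  assumes \<rho>: "parisi_measure \<gamma> \<rho>" and zero: "\<And>s. 0 \<le> s \<Longrightarrow> s < 1 \<Longrightarrow> \<gamma> s = 0"
  shows "s_P \<rho> = 1"
proof (rule ccontr)
  assume "s_P \<rho> \<noteq> 1"
  moreover have "s_P \<rho> \<in> Gam \<rho>"
    by (rule s_P_is_minimum(1)[OF \<rho>])
  ultimately have "s_P \<rho> \<in> supp \<rho>" "0 \<le> s_P \<rho>" "s_P \<rho> < 1"
    using Gam_bounds[OF \<rho>, of "s_P \<rho>"] by (auto simp: Gam_def)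
  then show False
    using positive_above_supp[OF \<rho>, of "s_P \<rho>" "(s_P \<rho> + 1) / 2"] zero[of "(s_P \<rho> + 1) / 2"] by simp
qed

lemma s_P_pos_if_zero:
  assumes \<rho>: "parisi_measure \<gamma> \<rho>" and \<epsilon>: "0 < \<epsilon>" "\<epsilon> < 1" "\<gamma> \<epsilon> = 0"
  shows "0 < s_P \<rho>"
proof (rule ccontr)
  assume "\<not> 0 < s_P \<rho>"
  moreover have "s_P \<rho> \<in> Gam \<rho>"
    by (rule s_P_is_minimum(1)[OF \<rho>])
  ultimately have "s_P \<rho> \<in> supp \<rho>" "s_P \<rho> < \<epsilon>"
    using \<epsilon> by (auto simp: Gam_def)
  then show False
    using positive_above_supp[OF \<rho>] \<epsilon> by force
qed

lemma s_P_eq_0_if_nonzero: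
  assumes \<rho>: "parisi_measure \<gamma> \<rho>" and pos: "\<And>s. 0 < s \<Longrightarrow> s < 1 \<Longrightarrow> 0 < \<gamma> s"
  shows "s_P \<rho> = 0"
proof -
  note sp = space_parisi_measure[OF \<rho>]
  have "0 < emeasure \<rho> (U \<inter> space \<rho>)" if U: "open U" "0 \<in> U" for U
  proof -
    obtain e where e: "0 < e" "ball 0 e \<subseteq> U"
      using U openE by blast
    define t where "t = min (e / 2) (1 / 2)"
    have t: "0 < t" "t < 1" "t < e"
      using e by (auto simp: t_def)
    have "{0..t} \<subseteq> U \<inter> space \<rho>"
      using e t by (auto simp: sp dist_real_def subset_iff)
    moreover have "U \<inter> space \<rho> \<in> sets \<rho>"
      using \<rho> U(1) by (auto simp: parisi_measure_def sets_restrict_space_iff sp)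
    ultimately have "emeasure \<rho> {0..t} \<le> emeasure \<rho> (U \<inter> space \<rho>)"
      by (rule emeasure_mono)
    moreover have "0 < emeasure \<rho> {0..t}"
      using \<rho> t pos[of t] by (simp add: parisi_measure_def)
    ultimately show ?thesis
      by (rule less_le_trans[rotated])
  qed
  then have "0 \<in> Gam \<rho>"
    by (simp add: Gam_def supp_def sp)
  then show ?thesis
    using s_P_is_minimum[OF \<rho>] Gam_bounds(1)[OF \<rho>] by (meson order_antisym)
qed


section \<open>The three regimes of \<open>s\<^sub>P\<close>\<close>

theorem proposition1:
  fixes h :: real and c :: "nat \<Rightarrow> real"
    and \<gamma>\<^sub>P :: "real \<Rightarrow> real" and \<Delta>\<^sub>P :: real and \<rho>\<^sub>P :: "real measure"
  assumes "0 \<le> h" and "mixture_coeffs c"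
    and "admissible \<gamma>\<^sub>P \<Delta>\<^sub>P"
    and "is_arg_min (Q_functional c h) (\<lambda>\<nu>. \<nu> \<in> K_set) (nu \<gamma>\<^sub>P \<Delta>\<^sub>P)"
    and "parisi_measure \<gamma>\<^sub>P \<rho>\<^sub>P"
  shows "(h = 0 \<longrightarrow>
            ((\<forall>s\<in>{0..1}. xi c s = s\<^sup>2) \<longrightarrow> s_P \<rho>\<^sub>P = 1) \<and>
            ((\<exists>p. even p \<and> 4 \<le> p \<and> c p \<noteq> 0) \<longrightarrow> s_P \<rho>\<^sub>P = 0)) \<and>
         (h \<noteq> 0 \<longrightarrow> 0 < s_P \<rho>\<^sub>P)"
proof (intro conjI impI)
  note c = assms(2) and \<rho> = assms(5)
  interpret energy_minimizer "\<lambda>s. deriv (xi c) s + h\<^sup>2" \<gamma>\<^sub>P \<Delta>\<^sub>P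
    by (rule minimizer_is_energy_minimizer[OF assms(2-4)])
  show "s_P \<rho>\<^sub>P = 1" if "h = 0" "\<forall>s\<in>{0..1}. xi c s = s\<^sup>2"
  proof (rule s_P_eq_1_if_zero[OF \<rho>])
    show "\<gamma>\<^sub>P s = 0" if "0 \<le> s" "s < 1" for s
      using that \<open>h = 0\<close> deriv_xi_square[OF c \<open>\<forall>s\<in>{0..1}. xi c s = s\<^sup>2\<close>]
      by (intro vanishes_if_linear) auto
  qed
  show "s_P \<rho>\<^sub>P = 0" if "h = 0" "\<exists>p. even p \<and> 4 \<le> p \<and> c p \<noteq> 0"
  proof (rule s_P_eq_0_if_nonzero[OF \<rho>])
    obtain p where p: "even p" "4 \<le> p" "c p \<noteq> 0"
      using \<open>\<exists>p. even p \<and> 4 \<le> p \<and> c p \<noteq> 0\<close> by blast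
    have "xi c 0 = 0"
      using xi_eq_suminf[OF c, of 0] even_coeff_less_2[of 0 c] by (simp add: powser_zero)
    then have "\<gamma>\<^sub>P s \<noteq> 0" if "0 < s" "s < 1" for s
      using that \<open>h = 0\<close> xi_has_deriv[OF c] two_xi_less_s_deriv_xi[OF c p]
      by (intro positive_if_superquadratic[where K="xi c"]) auto
    then show "0 < \<gamma>\<^sub>P s" if "0 < s" "s < 1" for s
      using finD(1)[of s] that by (simp add: less_le)
  qed
  show "0 < s_P \<rho>\<^sub>P" if "h \<noteq> 0"
  proof -
    have "\<exists>\<epsilon>. 0 < \<epsilon> \<and> \<epsilon> < 1 \<and> \<gamma>\<^sub>P \<epsilon> = 0"
      using that deriv_xi_nonneg[OF c] by (intro vanishes_near_0[of "h\<^sup>2"]) auto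
    then show ?thesis
      using s_P_pos_if_zero[OF \<rho>] by blast
  qed
qed

end
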